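(* Let $\beta\in\mathbb{R}\setminus\{0\}$ and let $X^\beta$ be the vector field on $\mathbb{R}^3$ given by $X^\beta(x,y,z)=(yz+\beta y)\partial_x+(xz-\beta x)\partial_y-xy\,\partial_z$. Let $M\neq0$ and $\Sigma_{M^2}:=\{(x,y,z)\in\mathbb{R}^3:\tfrac12(x^2+y^2)+z^2=M^2\}$, which contains the equilibrium $(0,0,M)$ and to which $X^\beta$ is tangent. Then: (a) the characteristic polynomial of the linearization of $X^\beta|_{\Sigma_{M^2}}$ at $(0,0,M)$ is $\mu^2+(\beta^2-M^2)$; (b) if $|\beta|<|M|$, $(0,0,M)$ is an unstable equilibrium of $X^\beta|_{\Sigma_{M^2}}$; (c) if $|\beta|>|M|$, $(0,0,M)$ is a Lyapunov stable equilibrium of $X^\beta|_{\Sigma_{M^2}}$; (d) if $|\beta|>|M|$, there exist $\varepsilon_0>0$ and a one-parameter family $\{\gamma_\varepsilon\}_{0<\varepsilon\le\varepsilon_0}\subset\Sigma_{M^2}$ of periodic orbits of $X^\beta|_{\Sigma_{M^2}}$ (hence of $X^\beta$) shrinking to $(0,0,M)$ as $\varepsilon\to0$, with periods $T_\varepsilon\to 2\pi/\sqrt{\beta^2-M^2}$ as $\varepsilon\to0$; moreover $\{(0,0,M)\}\cup\bigcup_{0<\varepsilon<\varepsilon_0}\gamma_\varepsilon$ is the connected component of $\Sigma_{M^2}\setminus\gamma_{\varepsilon_0}$ containing $(0,0,M)$.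
   Context: The linearization of a vector field $Y$ at an equilibrium $m$ (here of the restricted field on the surface $\Sigma_{M^2}$) is the linear endomorphism $v\mapsto\frac{\mathrm{d}}{\mathrm{d}t}(\mathrm{D}F^Y_t(m)v)|_{t=0}$ of the tangent space at $m$, $F^Y_t$ the flow. *)

theory Defs
  imports "HOL-Analysis.Analysis" "HOL-Computational_Algebra.Polynomial"
begin

type_synonym pt = "real \<times> real \<times> real"

definition Xb :: "real \<Rightarrow> pt \<Rightarrow> pt" where
  "Xb \<beta> p = (case p of (x, y, z) \<Rightarrow> (y*z + \<beta>*y, x*z - \<beta>*x, - x*y))"

definition SigmaM :: "real \<Rightarrow> pt set" where
  "SigmaM M = {(x, y, z). (x^2 + y^2) / 2 + z^2 = M^2}"

definition is_solution :: "real \<Rightarrow> pt \<Rightarrow> (real \<Rightarrow> pt) \<Rightarrow> bool" where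
  "is_solution \<beta> p \<gamma> \<longleftrightarrow> \<gamma> 0 = p \<and> (\<forall>t. (\<gamma> has_vector_derivative Xb \<beta> (\<gamma> t)) (at t))"

definition flow :: "real \<Rightarrow> real \<Rightarrow> pt \<Rightarrow> pt" where
  "flow \<beta> t p = (THE \<gamma>. is_solution \<beta> p \<gamma>) t"

definition tangent_space :: "pt set \<Rightarrow> pt \<Rightarrow> pt set" where
  "tangent_space S m = {v. \<exists>c. (\<forall>t. c t \<in> S) \<and> c 0 = m \<and> (c has_vector_derivative v) (at 0)}"

definition linearization :: "real \<Rightarrow> pt \<Rightarrow> pt \<Rightarrow> pt" where
  "linearization \<beta> m v = vector_derivative (\<lambda>t. frechet_derivative (flow \<beta> t) (at m) v) (at 0)"

text \<open>L is a linear endomorphism of the 2-dimensional subspace T with characteristic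
  polynomial p, i.e. det(mu I - A) = p(mu) for the matrix A of L in any basis of T.\<close>
definition has_charpoly2 :: "pt set \<Rightarrow> (pt \<Rightarrow> pt) \<Rightarrow> real poly \<Rightarrow> bool" where
  "has_charpoly2 T L p \<longleftrightarrow> subspace T \<and> dim T = 2 \<and> L ` T \<subseteq> T \<and>
     (\<forall>x\<in>T. \<forall>y\<in>T. L (x + y) = L x + L y) \<and> (\<forall>c. \<forall>x\<in>T. L (c *\<^sub>R x) = c *\<^sub>R L x) \<and>
     (\<forall>u v a b c d. u \<in> T \<and> v \<in> T \<and> u \<noteq> v \<and> independent {u, v} \<and>
        L u = a *\<^sub>R u + c *\<^sub>R v \<and> L v = b *\<^sub>R u + d *\<^sub>R v \<longrightarrow>
        p = [:a*d - b*c, -(a + d), 1:])"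

definition lyapunov_stable_on :: "real \<Rightarrow> pt set \<Rightarrow> pt \<Rightarrow> bool" where
  "lyapunov_stable_on \<beta> S m \<longleftrightarrow>
     (\<forall>e>0. \<exists>d>0. \<forall>p\<in>S. dist p m < d \<longrightarrow> (\<forall>t\<ge>0. dist (flow \<beta> t p) m < e))"

definition periodic_point :: "real \<Rightarrow> pt \<Rightarrow> real \<Rightarrow> bool" where
  "periodic_point \<beta> p T \<longleftrightarrow> T > 0 \<and> flow \<beta> T p = p \<and> (\<forall>t. 0 < t \<and> t < T \<longrightarrow> flow \<beta> t p \<noteq> p)"

definition orbit :: "real \<Rightarrow> pt \<Rightarrow> pt set" where
  "orbit \<beta> p = range (\<lambda>t. flow \<beta> t p)"

end

theory Submission
  imports Defs
begin

text \<open>Besides \<open>(x\<^sup>2 + y\<^sup>2) / 2 + z\<^sup>2\<close>, the field conserves \<open>(x\<^sup>2 - y\<^sup>2) / 2 + 2 \<beta> z\<close>. For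
  \<open>\<bar>M\<bar> < \<bar>\<beta>\<bar>\<close> the second integral has a strict extremum on the surface at \<open>(0, 0, M)\<close>, which gives
  stability. Moreover \<open>\<bar>z\<bar> \<le> \<bar>M\<bar> < \<bar>\<beta>\<bar>\<close> there, so \<open>x' = (z + \<beta>) y\<close>, \<open>y' = (z - \<beta>) x\<close> makes
  \<open>(x, y)\<close> turn around the origin with angular velocity bounded away from 0: every orbit
  crosses the meridian \<open>y = 0, x \<ge> 0\<close>, where the second integral is strictly monotone, so it
  closes up after one turn and fills a level set. After rescaling \<open>x\<close> and \<open>y\<close> the angular
  velocity tends to \<open>sqrt (\<beta>\<^sup>2 - M\<^sup>2)\<close> at the pole, which gives the limit of the periods.
  For \<open>\<bar>\<beta>\<bar> < \<bar>M\<bar>\<close>, \<open>M x y\<close> is a Chetaev function. The linearization is computed from a Gronwall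
  estimate of the quadratic remainder.\<close>

section \<open>Global solutions of Lipschitz differential equations\<close>

text \<open>\<open>flow\<close> selects, by definite description, a solution on the whole time axis,
  so nothing is known about it until global existence and uniqueness are proved; the field is
  quadratic and only locally Lipschitz. \<open>linearization\<close> differentiates the flow first
  in space and then in time, so the spatial derivative at the pole is needed for every time, not
  just its value to first order; an explicit candidate is compared with the flow. For |\<beta>| >
  |M| the eigenvalues are purely imaginary and the linear part decides neither stability nor
  periodicity; this is why integrals of motion carry parts (c) and (d). Since the meridian meets
  each orbit of the surface in exactly one point, periodicity, shrinking and the enclosed component
  all reduce to the monotonicity of one function of one real variable. Both signs of \<beta> and of
  M occur, which accounts for the factors \<open>sgn \<beta>\<close> and \<open>\<beta> * M\<close>
  below.\<close>

lemma continuous_antiderivative_real: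
  fixes f :: "real \<Rightarrow> 'a::banach"
  assumes "continuous_on UNIV f"
  shows "\<exists>F. F 0 = 0 \<and> (\<forall>t. (F has_vector_derivative f t) (at t))"
proof -
  \<comment> \<open>An integral over an empty interval is 0, so this difference is the oriented
    integral from 0 to t for either sign of t.\<close>
  define F where "F = (\<lambda>t. integral {0..t} f - integral {t..0} f)"
  have cont: "continuous_on S f" for S
    using assms continuous_on_subset by blast
  have "(F has_vector_derivative f t) (at t)" for t
  proof -
    \<comment> \<open>On this window t is an interior point and \<open>F\<close> differs from an
      integral with fixed lower end only by a constant, so the one-sided formula at the ends never
      enters.\<close>
    define R where "R = \<bar>t\<bar> + 1"
    have int: "f integrable_on {a..b}" for a b
      by (intro integrable_continuous_real cont)
    have split: "F u = integral {-R..u} f - integral {-R..0} f" if "u \<in> {-R<..<R}" for u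
    proof (cases "u \<ge> 0")
      case True
      then have "integral {u..0} f = 0"
        by (cases "u = 0") auto
      moreover have "integral {-R..0} f + integral {0..u} f = integral {-R..u} f"
        by (rule Henstock_Kurzweil_Integration.integral_combine)
          (use True that int in \<open>auto simp: R_def\<close>)
      ultimately show ?thesis
        by (simp add: F_def algebra_simps)
    next
      case False
      then have "integral {0..u} f = 0"
        by auto
      moreover have "integral {-R..u} f + integral {u..0} f = integral {-R..0} f"
        by (rule Henstock_Kurzweil_Integration.integral_combine)
          (use False that int in \<open>auto simp: R_def\<close>)
      ultimately show ?thesis
        by (simp add: F_def algebra_simps)
    qed
    have t: "t \<in> {-R<..<R}"
      by (auto simp: R_def)
    have "((\<lambda>u. integral {-R..u} f) has_vector_derivative f t) (at t within {-R..R})"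
      by (rule integral_has_vector_derivative) (use t cont in auto)
    then have "((\<lambda>u. integral {-R..u} f) has_vector_derivative f t) (at t)"
      using t by (simp add: at_within_Icc_at)
    then have "((\<lambda>u. integral {-R..u} f - integral {-R..0} f) has_vector_derivative f t) (at t)"
      by (auto intro: derivative_eq_intros)
    then show ?thesis
      by (rule has_vector_derivative_transform_within_open[where S="{-R<..<R}"])
        (use t split in auto)
  qed
  moreover have "F 0 = 0"
    by (simp add: F_def)
  ultimately show ?thesis
    by blast
qed

text \<open>Integration gains the factor 1 / K against the weight exp (K |t|); this gain is what
  makes the Picard operator contract. Negative times are reduced to positive ones by
  reflection.\<close>

lemma exp_weighted_bound:
  fixes F :: "real \<Rightarrow> 'a::real_normed_vector"
  assumes "F 0 = 0" and F': "\<And>t. (F has_vector_derivative f t) (at t)"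
    and f: "\<And>t. norm (f t) \<le> C * exp (K * \<bar>t\<bar>)" and K: "K > 0" and C: "C \<ge> 0"
  shows "norm (F t) \<le> C / K * exp (K * \<bar>t\<bar>)"
proof -
  have pos: "norm (G t) \<le> C / K * exp (K * t)"
    if G0: "G 0 = 0" and G': "\<And>t. (G has_vector_derivative g t) (at t)"
      and g: "\<And>t. norm (g t) \<le> C * exp (K * \<bar>t\<bar>)" and t: "t > 0"
    for G g :: "real \<Rightarrow> 'a" and t
  proof -
    have "norm (G t - G 0) \<le> C / K * exp (K * t) - C / K * exp (K * 0)"
    proof (rule differentiable_bound_general[where f'=g and \<phi>'="\<lambda>s. C * exp (K * s)"])
      show "continuous_on {0..t} G"
        using G' by (meson continuous_at_imp_continuous_on has_vector_derivative_continuous)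
      show "((\<lambda>s. C / K * exp (K * s)) has_vector_derivative C * exp (K * s)) (at s)" for s
        unfolding has_real_derivative_iff_has_vector_derivative[symmetric]
        using K by (auto intro!: derivative_eq_intros)
      show "norm (g s) \<le> C * exp (K * s)" if "0 < s" for s
        using g[of s] that by simp
    qed (use t K G' in \<open>auto intro!: continuous_intros\<close>)
    moreover have "C / K \<ge> 0"
      using K C by simp
    ultimately show ?thesis
      using G0 by simp
  qed
  consider "t > 0" | "t = 0" | "t < 0"
    by linarith
  then show ?thesis
  proof cases
    case 1
    then show ?thesis
      using pos[OF assms(1) F' f] by simp
  next
    case 2
    then show ?thesis
      using assms by simp
  next
    case 3
    have "((\<lambda>s. F (- s)) has_vector_derivative - f (- s)) (at s)" for s
    proof -
      have "(F \<circ> uminus has_vector_derivative (-1) *\<^sub>R f (- s)) (at s)"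
        by (rule vector_diff_chain_at) (auto intro!: derivative_eq_intros F')
      then show ?thesis
        by (simp add: o_def)
    qed
    then have "norm (F (- (- t))) \<le> C / K * exp (K * (- t))"
      by (rule pos[where g="\<lambda>s. - f (- s)", rotated]) (use 3 assms(1) f[of "- _"] in auto)
    then show ?thesis
      using 3 by simp
  qed
qed

text \<open>Measuring deviations from \<open>p\<close> with the weight \<open>exp (- K * \<bar>t\<bar>)\<close>, \<open>K > L\<close>, makes the Picard
  operator a contraction on the whole time axis, so no local solutions have to be glued.\<close>
lemma lipschitz_ode_global_solution:
  fixes f :: "'a::banach \<Rightarrow> 'a"
  assumes lip: "\<And>x y. norm (f x - f y) \<le> L * norm (x - y)" and L: "L \<ge> 0"
  shows "\<exists>u. u 0 = p \<and> (\<forall>t. (u has_vector_derivative f (u t)) (at t))"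
proof -
  define K where "K = L + 1"
  have K: "K > 0" "L / K < 1" "L / K \<ge> 0"
    using L by (auto simp: K_def)
  have "L-lipschitz_on UNIV f"
    using lip L by (auto simp: lipschitz_on_def dist_norm)
  then have contf: "continuous_on UNIV f"
    by (rule lipschitz_on_continuous_on)
  obtain I :: "(real \<Rightarrow> 'a) \<Rightarrow> real \<Rightarrow> 'a" where
    I: "\<And>g. continuous_on UNIV g \<Longrightarrow> I g 0 = 0"
       "\<And>g t. continuous_on UNIV g \<Longrightarrow> (I g has_vector_derivative g t) (at t)"
    using continuous_antiderivative_real by metis
  \<comment> \<open>The unknown \<open>v\<close> is the deviation from \<open>p\<close> divided by
    the weight. It ranges over bounded continuous functions, a complete space on which the fixed
    point theorem applies.\<close>
  define rhs where "rhs v s = f (p + exp (K * \<bar>s\<bar>) *\<^sub>R apply_bcontfun v s)"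
    for v :: "real \<Rightarrow>\<^sub>C 'a" and s
  have cont: "continuous_on UNIV (rhs v)" for v
    unfolding rhs_def
    by (rule continuous_on_compose2[OF contf]) (auto intro!: continuous_intros)
  define P where "P v t = exp (- (K * \<bar>t\<bar>)) *\<^sub>R I (rhs v) t" for v t
  have weight: "norm (exp (- (K * \<bar>t\<bar>)) *\<^sub>R a) \<le> c" if "norm a \<le> c * exp (K * \<bar>t\<bar>)"
    for a :: 'a and c t
    using that by (simp add: exp_minus field_simps)
  have P: "P v \<in> bcontfun" for v
  proof -
    obtain B where B: "B > 0" "\<And>t. norm (apply_bcontfun v t) \<le> B"
      using bounded_apply_bcontfun[of v] unfolding bounded_pos by auto
    have bnd: "norm (rhs v s) \<le> (norm (f p) + L * B) * exp (K * \<bar>s\<bar>)" for s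
    proof -
      have "norm (rhs v s) \<le> norm (f p) + norm (rhs v s - f p)"
        by (metis add.commute diff_add_cancel norm_triangle_ineq)
      also have "norm (rhs v s - f p) \<le> L * norm (exp (K * \<bar>s\<bar>) *\<^sub>R apply_bcontfun v s)"
        unfolding rhs_def using lip[of "p + exp (K * \<bar>s\<bar>) *\<^sub>R apply_bcontfun v s" p] by simp
      also have "\<dots> \<le> L * (exp (K * \<bar>s\<bar>) * B)"
        using L B by (intro mult_left_mono) auto
      also have "norm (f p) + L * (exp (K * \<bar>s\<bar>) * B)
          \<le> norm (f p) * exp (K * \<bar>s\<bar>) + L * (exp (K * \<bar>s\<bar>) * B)"
        using K by (intro add_right_mono mult_right_le_one_le[THEN order_trans])
          (auto simp: mult_le_cancel_left1)
      finally show ?thesis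
        by (simp add: algebra_simps)
    qed
    have "norm (P v t) \<le> (norm (f p) + L * B) / K" for t
      unfolding P_def
      by (intro weight exp_weighted_bound[where f="rhs v"])
        (use I cont bnd K L B in auto)
    moreover have "continuous_on UNIV (I (rhs v))"
      by (intro continuous_at_imp_continuous_on ballI has_vector_derivative_continuous[OF I(2)[OF cont]])
    then have "continuous_on UNIV (P v)"
      unfolding P_def by (intro continuous_intros)
    ultimately show ?thesis
      unfolding bcontfun_def bounded_iff by blast
  qed
  define \<Phi> where "\<Phi> v = Bcontfun (P v)" for v
  have \<Phi>: "apply_bcontfun (\<Phi> v) = P v" for v
    using P by (simp add: \<Phi>_def Bcontfun_inverse)
  have contr: "dist (\<Phi> v) (\<Phi> w) \<le> L / K * dist v w" for v w
  proof (rule dist_bound)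
    fix t
    have "norm (I (rhs v) t - I (rhs w) t) \<le> L * dist v w / K * exp (K * \<bar>t\<bar>)"
    proof (rule exp_weighted_bound[where f="\<lambda>s. rhs v s - rhs w s"])
      show "norm (rhs v s - rhs w s) \<le> L * dist v w * exp (K * \<bar>s\<bar>)" for s
      proof -
        have "norm (rhs v s - rhs w s)
            \<le> L * norm (exp (K * \<bar>s\<bar>) *\<^sub>R (apply_bcontfun v s - apply_bcontfun w s))"
          unfolding rhs_def
          using lip[of "p + exp (K * \<bar>s\<bar>) *\<^sub>R apply_bcontfun v s"
              "p + exp (K * \<bar>s\<bar>) *\<^sub>R apply_bcontfun w s"]
          by (simp add: algebra_simps)
        also have "\<dots> \<le> L * (exp (K * \<bar>s\<bar>) * dist v w)"
          using L dist_bounded[of v s w] by (intro mult_left_mono) (auto simp: dist_norm)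
        finally show ?thesis
          by (simp add: algebra_simps)
      qed
    qed (use I cont K L in \<open>auto intro!: derivative_eq_intros\<close>)
    from weight[OF this] show "dist (apply_bcontfun (\<Phi> v) t) (apply_bcontfun (\<Phi> w) t)
        \<le> L / K * dist v w"
      by (simp add: \<Phi> P_def dist_norm scaleR_diff_right)
  qed
  obtain v where v: "\<Phi> v = v"
    using banach_fix_type[of "L / K" \<Phi>] K contr by auto
  define u where "u = (\<lambda>t. p + I (rhs v) t)"
  have "u t = p + exp (K * \<bar>t\<bar>) *\<^sub>R apply_bcontfun v t" for t
    by (subst v[symmetric]) (simp add: \<Phi> P_def u_def exp_minus)
  then have "rhs v t = f (u t)" for t
    by (simp add: rhs_def)
  then have "(u has_vector_derivative f (u t)) (at t)" for t
    unfolding u_def using I(2)[OF cont, of v t] by (auto intro!: derivative_eq_intros)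
  moreover have "u 0 = p"
    using I(1)[OF cont] by (simp add: u_def)
  ultimately show ?thesis
    by blast
qed

text \<open>The squared norm is differentiable even where the norm is not; by Cauchy-Schwarz its
  derivative is at most 2 L times itself, so multiplying by exp (-2 L t) makes it nonincreasing.
  Negative times follow by time reversal.\<close>

lemma gronwall_norm_bound:
  fixes w :: "real \<Rightarrow> 'a::real_inner"
  assumes w': "\<And>s. \<bar>s\<bar> \<le> \<bar>t\<bar> \<Longrightarrow> (w has_vector_derivative w' s) (at s)"
    and bnd: "\<And>s. \<bar>s\<bar> \<le> \<bar>t\<bar> \<Longrightarrow> norm (w' s) \<le> L * norm (w s)"
  shows "norm (w t) \<le> exp (L * \<bar>t\<bar>) * norm (w 0)"
proof -
  have pos: "norm (w t) \<le> exp (L * t) * norm (w 0)"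
    if "t \<ge> 0" and w': "\<And>s. 0 \<le> s \<Longrightarrow> s \<le> t \<Longrightarrow> (w has_vector_derivative w' s) (at s)"
      and bnd: "\<And>s. 0 \<le> s \<Longrightarrow> s \<le> t \<Longrightarrow> norm (w' s) \<le> L * norm (w s)"
    for w w' :: "real \<Rightarrow> 'a" and t
  proof -
    have "(w t \<bullet> w t) * exp (- 2 * L * t) \<le> (w 0 \<bullet> w 0) * exp (- 2 * L * 0)"
    proof (rule DERIV_nonpos_imp_nonincreasing[OF \<open>t \<ge> 0\<close>])
      fix s assume s: "0 \<le> s" "s \<le> t"
      have "((\<lambda>s. w s \<bullet> w s) has_vector_derivative w s \<bullet> w' s + w' s \<bullet> w s) (at s)"
        using bounded_bilinear.has_vector_derivative[OF bounded_bilinear_inner w'[OF s] w'[OF s]] .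
      then have "((\<lambda>s. w s \<bullet> w s) has_real_derivative 2 * (w s \<bullet> w' s)) (at s)"
        by (simp add: has_real_derivative_iff_has_vector_derivative inner_commute)
      then have "((\<lambda>s. (w s \<bullet> w s) * exp (- 2 * L * s)) has_real_derivative
          2 * exp (- 2 * L * s) * (w s \<bullet> w' s - L * (w s \<bullet> w s))) (at s)"
        by (auto intro!: derivative_eq_intros simp: algebra_simps)
      moreover have "w s \<bullet> w' s \<le> L * (w s \<bullet> w s)"
      proof -
        have "w s \<bullet> w' s \<le> norm (w s) * norm (w' s)"
          by (rule norm_cauchy_schwarz)
        also have "\<dots> \<le> norm (w s) * (L * norm (w s))"
          by (intro mult_left_mono bnd s) auto
        finally show ?thesis
          by (simp add: dot_square_norm power2_eq_square algebra_simps)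
      qed
      ultimately show "\<exists>y. ((\<lambda>s. (w s \<bullet> w s) * exp (- 2 * L * s)) has_real_derivative y) (at s)
          \<and> y \<le> 0"
        by (meson diff_le_0_iff_le exp_ge_zero mult_nonneg_nonpos mult_nonneg_nonneg zero_le_numeral)
    qed
    then have "(norm (w t))\<^sup>2 \<le> (exp (L * t) * norm (w 0))\<^sup>2"
      by (simp add: dot_square_norm exp_minus power_mult_distrib exp_double[symmetric] field_simps)
    then show ?thesis
      by (rule power2_le_imp_le) simp
  qed
  show ?thesis
  proof (cases "t \<ge> 0")
    case True
    then show ?thesis
      using pos[OF True, of w w'] w' bnd by simp
  next
    case False
    have "norm (w (- (- t))) \<le> exp (L * (- t)) * norm (w (- 0))"
    proof (rule pos[where w'="\<lambda>s. - w' (- s)"])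
      fix s assume s: "0 \<le> s" "s \<le> - t"
      have "(w \<circ> uminus has_vector_derivative (-1) *\<^sub>R w' (- s)) (at s)"
        by (rule vector_diff_chain_at) (use s in \<open>auto intro!: derivative_eq_intros w'\<close>)
      then show "((\<lambda>s. w (- s)) has_vector_derivative - w' (- s)) (at s)"
        by (simp add: o_def)
      show "norm (- w' (- s)) \<le> L * norm (w (- s))"
        using bnd[of "- s"] s by simp
    qed (use False in simp)
    then show ?thesis
      using False by simp
  qed
qed

section \<open>The flow\<close>

lemma Xb_simp [simp]: "Xb \<beta> (x, y, z) = (y * z + \<beta> * y, x * z - \<beta> * x, - x * y)"
  by (simp add: Xb_def)

lemma norm_triple_le: "norm (x, y, z) \<le> \<bar>x\<bar> + \<bar>y\<bar> + \<bar>z\<bar>" for x y z :: real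
  using norm_Pair_le[of x "(y, z)"] norm_Pair_le[of y z] by simp

lemma abs_le_norm_triple:
  fixes x y z :: real
  shows "\<bar>x\<bar> \<le> norm (x, y, z)" "\<bar>y\<bar> \<le> norm (x, y, z)" "\<bar>z\<bar> \<le> norm (x, y, z)"
  using norm_fst_le[of x "(y, z)"] norm_snd_le[of "(y, z)" x] norm_fst_le[of y z] norm_snd_le[of z y]
  by auto

lemma norm_triple_squared: "(norm (x, y, z))\<^sup>2 = x\<^sup>2 + y\<^sup>2 + z\<^sup>2" for x y z :: real
  by (simp add: norm_Pair)

text \<open>In each component the product contributes 2 R and the linear term at most |\<beta>|; the
  factor 3 bounds the norm by the sum of the components.\<close>

lemma Xb_lipschitz_on_ball:
  assumes "norm p \<le> R" "norm q \<le> R"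
  shows "norm (Xb \<beta> p - Xb \<beta> q) \<le> 3 * (2 * R + \<bar>\<beta>\<bar>) * norm (p - q)"
proof -
  obtain x y z where p: "p = (x, y, z)" by (cases p)
  obtain x' y' z' where q: "q = (x', y', z')" by (cases q)
  define d where "d = norm (p - q)"
  have d: "\<bar>x - x'\<bar> \<le> d" "\<bar>y - y'\<bar> \<le> d" "\<bar>z - z'\<bar> \<le> d"
    using abs_le_norm_triple[where x="x - x'" and y="y - y'" and z="z - z'"] by (auto simp: d_def p q)
  have R: "\<bar>x\<bar> \<le> R" "\<bar>y\<bar> \<le> R" "\<bar>z\<bar> \<le> R" "\<bar>x'\<bar> \<le> R" "\<bar>y'\<bar> \<le> R" "\<bar>z'\<bar> \<le> R"
    using assms abs_le_norm_triple[where x=x and y=y and z=z]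
      abs_le_norm_triple[where x=x' and y=y' and z=z'] by (auto simp: p q)
  have prod: "\<bar>a * b - a' * b'\<bar> \<le> 2 * R * d"
    if "\<bar>a\<bar> \<le> R" "\<bar>b'\<bar> \<le> R" "\<bar>a - a'\<bar> \<le> d" "\<bar>b - b'\<bar> \<le> d" for a b a' b' :: real
  proof -
    have "\<bar>a * b - a' * b'\<bar> = \<bar>a * (b - b') + (a - a') * b'\<bar>"
      by (simp add: algebra_simps)
    also have "\<dots> \<le> \<bar>a\<bar> * \<bar>b - b'\<bar> + \<bar>a - a'\<bar> * \<bar>b'\<bar>"
      by (metis abs_mult abs_triangle_ineq)
    also have "\<dots> \<le> R * d + d * R"
      using that by (intro add_mono mult_mono) auto
    finally show ?thesis by simp
  qed
  have lin: "\<bar>\<beta> * (a - a')\<bar> \<le> \<bar>\<beta>\<bar> * d" if "\<bar>a - a'\<bar> \<le> d" for a a' :: real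
    using that by (simp add: abs_mult mult_left_mono)
  have "\<bar>(y * z + \<beta> * y) - (y' * z' + \<beta> * y')\<bar> \<le> (2 * R + \<bar>\<beta>\<bar>) * d"
    using prod[of y z' y' z] lin[of y y'] R d by (simp add: algebra_simps abs_le_iff)
  moreover have "\<bar>(x * z - \<beta> * x) - (x' * z' - \<beta> * x')\<bar> \<le> (2 * R + \<bar>\<beta>\<bar>) * d"
    using prod[of x z' x' z] lin[of x x'] R d by (simp add: algebra_simps abs_le_iff)
  moreover have "\<bar>(- x * y) - (- x' * y')\<bar> \<le> (2 * R + \<bar>\<beta>\<bar>) * d"
  proof -
    have "\<bar>(- x * y) - (- x' * y')\<bar> \<le> 2 * R * d"
      using prod[of x y' x' y] R d by (simp add: abs_minus_commute)
    also have "\<dots> \<le> (2 * R + \<bar>\<beta>\<bar>) * d"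
      by (intro mult_right_mono) (auto simp: d_def)
    finally show ?thesis .
  qed
  ultimately have "norm (Xb \<beta> p - Xb \<beta> q) \<le> 3 * ((2 * R + \<bar>\<beta>\<bar>) * d)"
    unfolding p q Xb_simp diff_Pair by (intro norm_triple_le[THEN order_trans]) linarith
  then show ?thesis
    by (simp only: d_def mult.assoc)
qed

lemma vector_derivative_components:
  fixes \<gamma> :: "real \<Rightarrow> pt"
  assumes "(\<gamma> has_vector_derivative (a, b, c)) F"
  shows "((\<lambda>t. fst (\<gamma> t)) has_vector_derivative a) F"
    "((\<lambda>t. fst (snd (\<gamma> t))) has_vector_derivative b) F"
    "((\<lambda>t. snd (snd (\<gamma> t))) has_vector_derivative c) F"
proof -
  note s = bounded_linear.has_vector_derivative[OF bounded_linear_snd assms]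
  show "((\<lambda>t. fst (\<gamma> t)) has_vector_derivative a) F"
    using bounded_linear.has_vector_derivative[OF bounded_linear_fst assms] by simp
  show "((\<lambda>t. fst (snd (\<gamma> t))) has_vector_derivative b) F"
    using bounded_linear.has_vector_derivative[OF bounded_linear_fst s] by simp
  show "((\<lambda>t. snd (snd (\<gamma> t))) has_vector_derivative c) F"
    using bounded_linear.has_vector_derivative[OF bounded_linear_snd s] by simp
qed

section \<open>Conservation of energy, global existence and uniqueness\<close>

lemma DERIV_zero_imp_eq:
  fixes f :: "real \<Rightarrow> real"
  assumes "\<And>t. (f has_real_derivative 0) (at t)"
  shows "f t = f s"
  by (rule DERIV_isconst_all) (use assms in blast)

definition energy :: "pt \<Rightarrow> real" where
  "energy p = (case p of (x, y, z) \<Rightarrow> (x\<^sup>2 + y\<^sup>2) / 2 + z\<^sup>2)"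

lemma SigmaM_iff_energy: "p \<in> SigmaM M \<longleftrightarrow> energy p = M\<^sup>2"
  by (auto simp: SigmaM_def energy_def)

lemma energy_bounds: "(norm p)\<^sup>2 \<le> 2 * energy p" "energy p \<le> (norm p)\<^sup>2"
proof -
  obtain x y z where p: "p = (x, y, z)" by (cases p)
  show "(norm p)\<^sup>2 \<le> 2 * energy p" "energy p \<le> (norm p)\<^sup>2"
    unfolding p norm_triple_squared energy_def prod.case
    using zero_le_power2[of x] zero_le_power2[of y] zero_le_power2[of z] by argo+
qed

text \<open>The energy lies between half the squared norm and the squared norm, so sqrt 2 would be
  the sharp factor; 2 keeps roots out of the later constants.\<close>

lemma norm_le_of_energy_eq:
  assumes "energy q = energy p"
  shows "norm q \<le> 2 * norm p"
proof -
  have "(norm q)\<^sup>2 \<le> (2 * norm p)\<^sup>2"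
    using energy_bounds[of p] energy_bounds[of q] assms zero_le_power2[of "norm p"]
    by (simp add: power_mult_distrib)
  then show ?thesis
    by (rule power2_le_imp_le) simp
qed

text \<open>The energy is conserved even for the field \<open>Xb \<beta>\<close> evaluated at a rescaled point. This makes
  the radial truncation of \<open>Xb \<beta>\<close>, which is globally Lipschitz, have bounded solutions.\<close>
lemma energy_conserved_rescaled:
  assumes "\<And>t. (\<gamma> has_vector_derivative Xb \<beta> (c t *\<^sub>R \<gamma> t)) (at t)"
  shows "energy (\<gamma> t) = energy (\<gamma> 0)"
proof -
  define x y z where "x t = fst (\<gamma> t)" and "y t = fst (snd (\<gamma> t))" and "z t = snd (snd (\<gamma> t))" for t
  have \<gamma>: "\<gamma> t = (x t, y t, z t)" for t
    by (simp add: x_def y_def z_def)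
  note d = vector_derivative_components[OF assms[unfolded \<gamma> scaleR_Pair Xb_simp],
      folded has_real_derivative_iff_has_vector_derivative, unfolded fst_conv snd_conv real_scaleR_def]
  have "((\<lambda>t. energy (\<gamma> t)) has_real_derivative 0) (at t)" for t
    unfolding \<gamma> energy_def
    by (auto intro!: derivative_eq_intros d[THEN DERIV_cong] simp: algebra_simps power2_eq_square)
  then show ?thesis
    by (rule DERIV_zero_imp_eq)
qed

text \<open>Truncation by metric projection is nonexpansive for general convexity reasons; this
  formula shows that it only rescales its argument, which is the shape that
  \<open>energy_conserved_rescaled\<close> handles.\<close>

lemma closest_point_cball_0:
  fixes a :: "'a::euclidean_space"
  assumes "R > 0"
  shows "closest_point (cball 0 R) a = (R / max R (norm a)) *\<^sub>R a"
proof (rule closest_point_unique[symmetric])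
  show "(R / max R (norm a)) *\<^sub>R a \<in> cball 0 R"
    using assms by (auto simp: divide_simps max_def)
  show "\<forall>z\<in>cball 0 R. dist a ((R / max R (norm a)) *\<^sub>R a) \<le> dist a z"
  proof
    fix z :: 'a assume z: "z \<in> cball 0 R"
    show "dist a ((R / max R (norm a)) *\<^sub>R a) \<le> dist a z"
    proof (cases "norm a \<le> R")
      case True
      then show ?thesis
        using assms by (simp add: max_def)
    next
      case False
      have "0 \<le> 1 - R / norm a"
        using False assms by (simp add: divide_le_eq)
      moreover have "a - (R / norm a) *\<^sub>R a = (1 - R / norm a) *\<^sub>R a"
        by (simp add: algebra_simps)
      ultimately have "dist a ((R / norm a) *\<^sub>R a) = (1 - R / norm a) * norm a"
        using False assms by (simp add: dist_norm)
      also have "\<dots> = norm a - R"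
        using False assms by (auto simp: field_simps)
      also have "\<dots> \<le> dist a z"
        using z norm_triangle_ineq2[of a z] by (simp add: dist_norm)
      finally show ?thesis
        using False by (simp add: max_def)
    qed
  qed
qed auto

lemma is_solution_exists: "\<exists>\<gamma>. is_solution \<beta> p \<gamma>"
proof -
  \<comment> \<open>Energy conservation confines the truncated solution to radius 2 |p|, where the
    truncation is inactive; the summand 1 keeps the radius positive for p = 0.\<close>
  define R where "R = 2 * norm p + 1"
  have R: "R > 0"
    by (simp add: R_def add_nonneg_pos)
  define \<pi> :: "pt \<Rightarrow> pt" where "\<pi> = closest_point (cball 0 R)"
  define L where "L = 3 * (2 * R + \<bar>\<beta>\<bar>)"
  have L: "L \<ge> 0"
    using R by (simp add: L_def)
  have "norm (Xb \<beta> (\<pi> u) - Xb \<beta> (\<pi> v)) \<le> L * norm (u - v)" for u v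
  proof -
    have "\<pi> w \<in> cball 0 R" for w
      unfolding \<pi>_def by (rule closest_point_in_set) (use R in auto)
    then have "norm (Xb \<beta> (\<pi> u) - Xb \<beta> (\<pi> v)) \<le> L * norm (\<pi> u - \<pi> v)"
      unfolding L_def by (intro Xb_lipschitz_on_ball) auto
    also have "\<dots> \<le> L * norm (u - v)"
      using closest_point_lipschitz[of "cball (0::pt) R" u v] R L
      by (intro mult_left_mono) (auto simp: \<pi>_def dist_norm)
    finally show ?thesis .
  qed
  then obtain \<gamma> where \<gamma>: "\<gamma> 0 = p" "\<And>t. (\<gamma> has_vector_derivative Xb \<beta> (\<pi> (\<gamma> t))) (at t)"
    using lipschitz_ode_global_solution[of "\<lambda>u. Xb \<beta> (\<pi> u)" L p] L by blast
  have \<pi>: "\<pi> q = (R / max R (norm q)) *\<^sub>R q" for q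
    unfolding \<pi>_def by (rule closest_point_cball_0[OF R])
  have "energy (\<gamma> t) = energy p" for t
    using energy_conserved_rescaled[OF \<gamma>(2)[unfolded \<pi>], of t] \<gamma>(1) by simp
  then have "norm (\<gamma> t) \<le> R" for t
    using norm_le_of_energy_eq[of "\<gamma> t" p] by (simp add: R_def)
  then have "\<pi> (\<gamma> t) = \<gamma> t" for t
    using R by (simp add: \<pi> max_absorb1)
  then show ?thesis
    using \<gamma> unfolding is_solution_def by auto
qed

lemma is_solution_energy:
  assumes "is_solution \<beta> p \<gamma>"
  shows "energy (\<gamma> t) = energy p"
  using assms energy_conserved_rescaled[of \<gamma> \<beta> "\<lambda>_. 1" t] by (simp add: is_solution_def)

text \<open>Energy keeps both solutions in the ball of radius \<open>R\<close>, where the field is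
  Lipschitz. With p = q this is uniqueness; near the pole it bounds the deviation of the flow
  linearly in the initial displacement.\<close>

lemma is_solution_dependence:
  assumes "is_solution \<beta> p \<gamma>" "is_solution \<beta> q \<delta>" "2 * norm p \<le> R" "2 * norm q \<le> R"
  shows "norm (\<gamma> t - \<delta> t) \<le> exp (3 * (2 * R + \<bar>\<beta>\<bar>) * \<bar>t\<bar>) * norm (p - q)"
proof -
  have "norm (\<gamma> s) \<le> R" "norm (\<delta> s) \<le> R" for s
    using norm_le_of_energy_eq is_solution_energy[OF assms(1)] is_solution_energy[OF assms(2)] assms(3,4)
    by (meson order_trans)+
  then have "norm (\<gamma> t - \<delta> t) \<le> exp (3 * (2 * R + \<bar>\<beta>\<bar>) * \<bar>t\<bar>) * norm (\<gamma> 0 - \<delta> 0)"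
    using assms(1,2)
    by (intro gronwall_norm_bound[where w'="\<lambda>s. Xb \<beta> (\<gamma> s) - Xb \<beta> (\<delta> s)"]
        has_vector_derivative_diff Xb_lipschitz_on_ball) (auto simp: is_solution_def)
  then show ?thesis
    using assms(1,2) by (simp add: is_solution_def)
qed

lemma is_solution_unique:
  assumes "is_solution \<beta> p \<gamma>" "is_solution \<beta> p \<delta>"
  shows "\<gamma> = \<delta>"
  using is_solution_dependence[OF assms order_refl order_refl] by (auto simp: fun_eq_iff)

lemma flow_eqI: "is_solution \<beta> p \<gamma> \<Longrightarrow> flow \<beta> t p = \<gamma> t"
  unfolding flow_def using is_solution_unique by (metis the_equality)

lemma flow_is_solution: "is_solution \<beta> p (\<lambda>t. flow \<beta> t p)"
  using is_solution_exists flow_eqI by (metis ext)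

lemma flow_0 [simp]: "flow \<beta> 0 p = p"
  using flow_is_solution by (simp add: is_solution_def)

lemma flow_has_vector_derivative:
  "((\<lambda>t. flow \<beta> t p) has_vector_derivative Xb \<beta> (flow \<beta> t p)) (at t)"
  using flow_is_solution by (simp add: is_solution_def)

lemma flow_add: "flow \<beta> (s + t) p = flow \<beta> s (flow \<beta> t p)"
proof -
  have "((\<lambda>s. flow \<beta> (s + t) p) has_vector_derivative Xb \<beta> (flow \<beta> (s + t) p)) (at s)" for s
  proof -
    have "((\<lambda>s. flow \<beta> s p) \<circ> (\<lambda>s. s + t) has_vector_derivative 1 *\<^sub>R Xb \<beta> (flow \<beta> (s + t) p)) (at s)"
      by (rule vector_diff_chain_at)
        (auto intro!: derivative_eq_intros flow_has_vector_derivative)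
    then show ?thesis
      by (simp add: o_def)
  qed
  then have "is_solution \<beta> (flow \<beta> t p) (\<lambda>s. flow \<beta> (s + t) p)"
    by (simp add: is_solution_def)
  then show ?thesis
    by (simp add: flow_eqI)
qed

lemma flow_equilibrium: "Xb \<beta> p = 0 \<Longrightarrow> flow \<beta> t p = p"
  by (rule flow_eqI) (simp add: is_solution_def)

lemma energy_flow [simp]: "energy (flow \<beta> t p) = energy p"
  by (rule is_solution_energy[OF flow_is_solution])

lemma flow_in_SigmaM: "p \<in> SigmaM M \<Longrightarrow> flow \<beta> t p \<in> SigmaM M"
  by (simp add: SigmaM_iff_energy)

lemma continuous_on_flow: "continuous_on S (\<lambda>t. flow \<beta> t p)"
  by (intro continuous_at_imp_continuous_on ballI
      has_vector_derivative_continuous[OF flow_has_vector_derivative])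

lemma orbit_self: "p \<in> orbit \<beta> p"
  unfolding orbit_def by (metis flow_0 rangeI)

lemma orbit_flow: "orbit \<beta> (flow \<beta> t p) = orbit \<beta> p"
proof -
  have "flow \<beta> s p = flow \<beta> (s - t) (flow \<beta> t p)" for s
    by (simp flip: flow_add)
  moreover have "flow \<beta> s (flow \<beta> t p) = flow \<beta> (s + t) p" for s
    by (simp add: flow_add)
  ultimately show ?thesis
    unfolding orbit_def by (metis (no_types, lifting) image_subset_iff rangeI subset_antisym)
qed

lemma connected_orbit: "connected (orbit \<beta> p)"
  unfolding orbit_def by (intro connected_continuous_image continuous_on_flow connected_UNIV)

section \<open>The linearization at the pole\<close>

text \<open>A fundamental system of u'' = k u. It will be used with k = M^2 - \<beta>^2 of any sign,
  so that part (a) needs no case split and includes |\<beta>| = |M|.\<close>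

lemma linear_oscillator_solution:
  fixes k :: real
  shows "\<exists>c s. c 0 = 1 \<and> s 0 = 0 \<and> (\<forall>t. (c has_real_derivative k * s t) (at t)) \<and>
    (\<forall>t. (s has_real_derivative c t) (at t))"
proof -
  consider "k > 0" | "k = 0" | "k < 0"
    by linarith
  then show ?thesis
  proof cases
    case 1
    define w where "w = sqrt k"
    have w: "w \<noteq> 0" "w * w = k"
      using 1 by (auto simp: w_def)
    show ?thesis
      by (rule exI[of _ "\<lambda>t. cosh (w * t)"], rule exI[of _ "\<lambda>t. sinh (w * t) / w"])
        (use w in \<open>auto intro!: derivative_eq_intros simp: field_simps simp flip: w(2)\<close>)
  next
    case 2
    show ?thesis
      by (rule exI[of _ "\<lambda>t. 1"], rule exI[of _ "\<lambda>t. t"])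
        (use 2 in \<open>auto intro!: derivative_eq_intros\<close>)
  next
    case 3
    define w where "w = sqrt (- k)"
    have w: "w \<noteq> 0" "k = - (w * w)"
      using 3 by (auto simp: w_def)
    show ?thesis
      by (rule exI[of _ "\<lambda>t. cos (w * t)"], rule exI[of _ "\<lambda>t. sin (w * t) / w"])
        (use w in \<open>auto intro!: derivative_eq_intros simp: field_simps\<close>)
  qed
qed

lemma has_derivative_if_quadratic_remainder:
  fixes f :: "'a::real_normed_vector \<Rightarrow> 'b::real_normed_vector"
  assumes "bounded_linear D"
    and rem: "\<And>h. norm h \<le> 1 \<Longrightarrow> norm (f (x + h) - f x - D h) \<le> C * (norm h)\<^sup>2"
  shows "(f has_derivative D) (at x)"
  unfolding has_derivative_at
proof
  show "(\<lambda>h. norm (f (x + h) - f x - D h) / norm h) \<midarrow>0\<rightarrow> 0"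
  proof (rule Lim_null_comparison)
    have "\<forall>\<^sub>F h :: 'a in at 0. norm h < 1 \<and> h \<noteq> 0"
      unfolding eventually_at by (intro exI[of _ 1]) auto
    then show "\<forall>\<^sub>F h in at 0. norm (norm (f (x + h) - f x - D h) / norm h) \<le> C * norm h"
    proof eventually_elim
      case (elim h)
      then show ?case
        using rem[of h] by (simp add: divide_le_eq power2_eq_square mult.assoc)
    qed
    have "((\<lambda>h :: 'a. C * norm h) \<longlongrightarrow> C * norm (0 :: 'a)) (at 0)"
      by (intro tendsto_intros)
    then show "((\<lambda>h :: 'a. C * norm h) \<longlongrightarrow> 0) (at 0)"
      by simp
  qed
qed fact

text \<open>The Jacobian of \<open>Xb\<close> at the pole. Its square is M^2 - \<beta>^2 times the
  projection to the first two coordinates, so its exponential comes from a scalar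
  oscillator.\<close>

definition pole_matrix :: "real \<Rightarrow> real \<Rightarrow> pt \<Rightarrow> pt" where
  "pole_matrix \<beta> M v = ((M + \<beta>) * fst (snd v), (M - \<beta>) * fst v, 0)"

lemma flow_pole [simp]: "flow \<beta> t (0, 0, M) = (0, 0, M)"
  by (rule flow_equilibrium) (simp add: zero_prod_def)

lemma Xb_pole_remainder:
  "norm (Xb \<beta> ((0, 0, M) + h) - pole_matrix \<beta> M h) \<le> 3 * (norm h)\<^sup>2"
proof -
  obtain a b c where h: "h = (a, b, c)" by (cases h)
  have prod: "\<bar>u * v\<bar> \<le> (norm h)\<^sup>2" if "\<bar>u\<bar> \<le> norm h" "\<bar>v\<bar> \<le> norm h" for u v :: real
    unfolding abs_mult power2_eq_square by (intro mult_mono that) auto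
  have "Xb \<beta> ((0, 0, M) + h) - pole_matrix \<beta> M h = (b * c, a * c, - (a * b))"
    by (simp add: h pole_matrix_def algebra_simps)
  also have "norm \<dots> \<le> 3 * (norm h)\<^sup>2"
    using prod[of b c] prod[of a c] prod[of a b]
      abs_le_norm_triple[where x=a and y=b and z=c, folded h]
    by (intro norm_triple_le[THEN order_trans]) simp
  finally show ?thesis .
qed

lemma norm_pole_matrix_le: "norm (pole_matrix \<beta> M v) \<le> (\<bar>M + \<beta>\<bar> + \<bar>M - \<beta>\<bar>) * norm v"
proof -
  obtain a b c where v: "v = (a, b, c)" by (cases v)
  have "\<bar>(M + \<beta>) * b\<bar> \<le> \<bar>M + \<beta>\<bar> * norm v" "\<bar>(M - \<beta>) * a\<bar> \<le> \<bar>M - \<beta>\<bar> * norm v"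
    unfolding abs_mult using abs_le_norm_triple[where x=a and y=b and z=c, folded v]
    by (auto intro: mult_left_mono)
  then show ?thesis
    unfolding pole_matrix_def
    by (intro norm_triple_le[THEN order_trans]) (simp add: v algebra_simps)
qed

text \<open>\<open>D t\<close> is the exponential of t times \<open>pole_matrix\<close>. The
  displacement of the flow solves the same linear equation up to an inhomogeneity that is quadratic
  in \<open>v\<close>, uniformly on the time interval considered, and Gronwall passes this order on
  to the difference.\<close>

lemma flow_has_derivative_at_pole:
  assumes "c 0 = 1" "s 0 = 0" "\<And>t. (c has_real_derivative (M\<^sup>2 - \<beta>\<^sup>2) * s t) (at t)"
    "\<And>t. (s has_real_derivative c t) (at t)"
  defines "D \<equiv> \<lambda>t v. (c t * fst v + (M + \<beta>) * s t * fst (snd v),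
    c t * fst (snd v) + (M - \<beta>) * s t * fst v, snd (snd v))"
  shows "(flow \<beta> t has_derivative D t) (at (0, 0, M))"
    and "((\<lambda>t. D t v) has_vector_derivative pole_matrix \<beta> M (D t v)) (at t)"
proof -
  show D': "((\<lambda>t. D t v) has_vector_derivative pole_matrix \<beta> M (D t v)) (at t)" for t v
    unfolding D_def pole_matrix_def
    by (intro has_vector_derivative_Pair)
      (auto intro!: derivative_eq_intros assms(3,4)[THEN DERIV_cong]
        simp: power2_eq_square algebra_simps simp flip: has_real_derivative_iff_has_vector_derivative)
  define m :: pt where "m = (0, 0, M)"
  \<comment> \<open>Large enough for \<open>is_solution_dependence\<close> at the pole and at every
    point within distance 1 of it.\<close>
  define R where "R = 2 * (norm m + 1)"
  define L where "L = 3 * (2 * R + \<bar>\<beta>\<bar>)"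
  define N where "N = \<bar>M + \<beta>\<bar> + \<bar>M - \<beta>\<bar>"
  have L: "L \<ge> 0"
    by (simp add: L_def R_def)
  have "norm (flow \<beta> t (m + v) - flow \<beta> t m - D t v)
      \<le> (3 * (exp (L * \<bar>t\<bar>))\<^sup>2 * exp ((N + 1) * \<bar>t\<bar>)) * (norm v)\<^sup>2" if v: "norm v \<le> 1" for v
  proof -
    define h where "h r = flow \<beta> r (m + v) - m" for r
    define \<epsilon> where "\<epsilon> = 3 * (exp (L * \<bar>t\<bar>) * norm v)\<^sup>2"
    have \<epsilon>: "\<epsilon> \<ge> 0"
      by (simp add: \<epsilon>_def)
    \<comment> \<open>Carrying the bound of the inhomogeneity along as a constant component makes the
      differential inequality homogeneous.\<close>
    define w where "w r = (h r - D r v, \<epsilon>)" for r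
    \<comment> \<open>The rate is \<open>N\<close> for the linear part plus 1 for the inhomogeneity,
      which is at most the constant component \<open>\<epsilon>\<close> of \<open>w\<close>.\<close>
    have "norm (w t) \<le> exp ((N + 1) * \<bar>t\<bar>) * norm (w 0)"
    proof (rule gronwall_norm_bound)
      fix r assume r: "\<bar>r\<bar> \<le> \<bar>t\<bar>"
      have "((\<lambda>r. flow \<beta> r (m + v) - m - D r v) has_vector_derivative
          Xb \<beta> (m + h r) - 0 - pole_matrix \<beta> M (D r v)) (at r)"
        unfolding h_def
        by (intro has_vector_derivative_diff has_vector_derivative_const D')
          (use flow_has_vector_derivative in simp)
      then show "(w has_vector_derivative (Xb \<beta> (m + h r) - pole_matrix \<beta> M (D r v), 0)) (at r)"
        unfolding w_def h_def
        by (intro has_vector_derivative_Pair has_vector_derivative_const) simp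
      have "norm (h r) \<le> exp (L * \<bar>r\<bar>) * norm v"
      proof -
        have "norm (m + v) \<le> norm m + 1"
          using norm_triangle_ineq[of m v] v by linarith
        then have "norm (flow \<beta> r (m + v) - flow \<beta> r m) \<le> exp (L * \<bar>r\<bar>) * norm (m + v - m)"
          unfolding L_def
          by (intro is_solution_dependence flow_is_solution) (auto simp: R_def)
        then show ?thesis
          by (simp add: h_def m_def)
      qed
      also have "\<dots> \<le> exp (L * \<bar>t\<bar>) * norm v"
        using r L by (intro mult_right_mono) (auto intro: mult_left_mono)
      finally have h: "3 * (norm (h r))\<^sup>2 \<le> \<epsilon>"
        unfolding \<epsilon>_def by (intro mult_left_mono power_mono) auto
      have lin: "pole_matrix \<beta> M (a - b) = pole_matrix \<beta> M a - pole_matrix \<beta> M b" for a b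
        by (simp add: pole_matrix_def algebra_simps)
      have "Xb \<beta> (m + h r) - pole_matrix \<beta> M (D r v) =
          (Xb \<beta> (m + h r) - pole_matrix \<beta> M (h r)) + pole_matrix \<beta> M (h r - D r v)"
        by (simp add: lin)
      also have "norm \<dots> \<le> \<epsilon> + N * norm (h r - D r v)"
        using Xb_pole_remainder[of \<beta> M "h r"] norm_pole_matrix_le[of \<beta> M "h r - D r v"] h
        unfolding m_def N_def by (intro norm_triangle_le) linarith
      also have "\<dots> \<le> norm (w r) + N * norm (w r)"
        unfolding w_def
        using norm_fst_le[of "h r - D r v" \<epsilon>] norm_snd_le[of \<epsilon> "h r - D r v"] \<epsilon>
        by (intro add_mono mult_left_mono) (auto simp: N_def)
      finally show "norm (Xb \<beta> (m + h r) - pole_matrix \<beta> M (D r v), 0::real) \<le> (N + 1) * norm (w r)"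
        by (simp add: norm_Pair algebra_simps)
    qed
    moreover have "w 0 = (0, \<epsilon>)"
      by (simp add: w_def h_def D_def assms(1,2))
    moreover have "norm (h t - D t v) \<le> norm (w t)"
      by (simp add: w_def norm_fst_le)
    ultimately have "norm (h t - D t v) \<le> exp ((N + 1) * \<bar>t\<bar>) * \<epsilon>"
      using \<epsilon> by (simp add: norm_Pair)
    then show ?thesis
      by (simp add: h_def \<epsilon>_def m_def power_mult_distrib mult_ac)
  qed
  moreover have "bounded_linear (D t)"
    unfolding D_def linear_conv_bounded_linear[symmetric]
    by (rule linearI) (auto simp: algebra_simps)
  ultimately show "(flow \<beta> t has_derivative D t) (at (0, 0, M))"
    unfolding m_def by (rule has_derivative_if_quadratic_remainder[rotated])
qed

lemma linearization_pole: "linearization \<beta> (0, 0, M) v = pole_matrix \<beta> M v"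
proof -
  obtain c s where cs: "c 0 = 1" "s 0 = 0"
    "\<And>t. (c has_real_derivative (M\<^sup>2 - \<beta>\<^sup>2) * s t) (at t)" "\<And>t. (s has_real_derivative c t) (at t)"
    using linear_oscillator_solution by blast
  note d = flow_has_derivative_at_pole[OF cs]
  show ?thesis
    unfolding linearization_def frechet_derivative_at[OF d(1), symmetric]
    by (rule vector_derivative_at) (use d(2)[of v 0] cs in simp)
qed

lemma tangent_space_pole:
  assumes "M \<noteq> 0"
  shows "tangent_space (SigmaM M) (0, 0, M) = {v. snd (snd v) = 0}"
proof (intro equalityI subsetI)
  fix v assume "v \<in> tangent_space (SigmaM M) (0, 0, M)"
  then obtain \<gamma> where \<gamma>: "\<And>t. \<gamma> t \<in> SigmaM M" "\<gamma> 0 = (0, 0, M)" "(\<gamma> has_vector_derivative v) (at 0)"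
    unfolding tangent_space_def by auto
  obtain a b c where v: "v = (a, b, c)" by (cases v)
  define x y z where "x t = fst (\<gamma> t)" and "y t = fst (snd (\<gamma> t))" and "z t = snd (snd (\<gamma> t))" for t
  have xyz: "\<gamma> t = (x t, y t, z t)" for t
    by (simp add: x_def y_def z_def)
  have 0: "x 0 = 0" "y 0 = 0" "z 0 = M"
    using \<gamma>(2) xyz by auto
  note d = vector_derivative_components[OF \<gamma>(3)[unfolded v],
      folded x_def y_def z_def has_real_derivative_iff_has_vector_derivative]
  \<comment> \<open>At the pole the gradient of the constraint is vertical, of length 2 |M|, so
    differentiating the constraint leaves only the vertical velocity.\<close>
  have "((\<lambda>t. ((x t)\<^sup>2 + (y t)\<^sup>2) / 2 + (z t)\<^sup>2) has_real_derivative 2 * M * c) (at 0)"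
    by (auto intro!: derivative_eq_intros d[THEN DERIV_cong] simp: 0)
  moreover have "((x t)\<^sup>2 + (y t)\<^sup>2) / 2 + (z t)\<^sup>2 = M\<^sup>2" for t
    using \<gamma>(1)[of t] by (simp add: SigmaM_def xyz)
  ultimately have "((\<lambda>t. M\<^sup>2) has_real_derivative 2 * M * c) (at 0)"
    by simp
  then have "2 * M * c = 0"
    by (rule DERIV_unique) (rule DERIV_const)
  then show "v \<in> {v. snd (snd v) = 0}"
    using assms by (simp add: v)
next
  fix v :: pt assume "v \<in> {v. snd (snd v) = 0}"
  then obtain a b where v: "v = (a, b, 0)" by (cases v) auto
  show "v \<in> tangent_space (SigmaM M) (0, 0, M)"
  proof (cases "v = 0")
    case True
    then show ?thesis
      unfolding tangent_space_def
      by (auto intro!: exI[of _ "\<lambda>_. (0, 0, M)"] simp: SigmaM_def)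
  next
    case False
    define r where "r = sqrt ((a\<^sup>2 + b\<^sup>2) / 2)"
    have r: "r \<noteq> 0" "a\<^sup>2 + b\<^sup>2 = 2 * r\<^sup>2"
      using False by (auto simp: r_def v zero_prod_def sum_power2_eq_zero_iff)
    \<comment> \<open>\<open>tangent_space\<close> asks for a curve that stays on the surface for
      all times: this one traverses the section of the surface by the plane through \<open>v\<close>
      and the z-axis, with the speed scaled to give velocity \<open>v\<close> at 0.\<close>
    define \<gamma> where "\<gamma> t = (a * (M / r * sin (r / M * t)), b * (M / r * sin (r / M * t)), M * cos (r / M * t))"
      for t
    have "\<gamma> t \<in> SigmaM M" for t
    proof -
      have "((a * (M / r * sin (r / M * t)))\<^sup>2 + (b * (M / r * sin (r / M * t)))\<^sup>2) / 2
          = (a\<^sup>2 + b\<^sup>2) / 2 * (M / r * sin (r / M * t))\<^sup>2"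
        unfolding power_mult_distrib[of a] power_mult_distrib[of b] by (simp only: distrib_right add_divide_distrib times_divide_eq_left)
      also have "\<dots> = M\<^sup>2 * (sin (r / M * t))\<^sup>2"
        using r by (simp add: power_mult_distrib power_divide)
      finally show ?thesis
        unfolding SigmaM_def \<gamma>_def using sin_cos_squared_add[of "r / M * t"]
        by (simp add: power_mult_distrib flip: distrib_left)
    qed
    moreover have "\<gamma> 0 = (0, 0, M)"
      by (simp add: \<gamma>_def)
    moreover have "(\<gamma> has_vector_derivative v) (at 0)"
      unfolding \<gamma>_def v
      by (intro has_vector_derivative_Pair)
        (use r assms in \<open>auto intro!: derivative_eq_intros
          simp flip: has_real_derivative_iff_has_vector_derivative\<close>)
    ultimately show ?thesis
      unfolding tangent_space_def by blast
  qed
qed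

text \<open>\<open>has_charpoly2\<close> ranges over all bases. For an arbitrary one, trace and
  determinant of the coefficient matrix are determined after multiplication by the determinant
  \<open>\<Delta>\<close> of the basis, which is nonzero.\<close>

lemma charpoly_pole_matrix:
  "has_charpoly2 {v. snd (snd v) = 0} (pole_matrix \<beta> M) [:\<beta>\<^sup>2 - M\<^sup>2, 0, 1:]"
proof -
  let ?T = "{v :: pt. snd (snd v) = 0}"
  have "?T = span {(1, 0, 0), (0, 1, 0)}"
  proof -
    have "(a, b, 0) = a *\<^sub>R (1, 0, 0) + b *\<^sub>R (0, 1, 0 :: real)" for a b :: real
      by simp
    then show ?thesis
      by (auto simp: span_insert span_0 algebra_simps)
  qed
  moreover have "independent {(1, 0, 0), (0, 1, 0 :: real) :: real \<times> real \<times> real}"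
    by (auto simp: independent_insert span_singleton zero_prod_def)
  ultimately have "dim ?T = 2"
    by (simp add: dim_eq_card_independent)
  moreover have "subspace ?T"
    by (auto simp: subspace_def)
  moreover have "[:\<beta>\<^sup>2 - M\<^sup>2, 0, 1:] = [:a * d - b * c, - (a + d), 1:]"
    if uv: "u \<in> ?T" "v \<in> ?T" "u \<noteq> v" and ind: "independent {u, v}"
      and u: "pole_matrix \<beta> M u = a *\<^sub>R u + c *\<^sub>R v" and v: "pole_matrix \<beta> M v = b *\<^sub>R u + d *\<^sub>R v"
    for u v a b c d
  proof -
    obtain u1 u2 where u12: "u = (u1, u2, 0)" using uv by (cases u) auto
    obtain v1 v2 where v12: "v = (v1, v2, 0)" using uv by (cases v) auto
    define \<Delta> where "\<Delta> = u1 * v2 - u2 * v1"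
    have "\<Delta> \<noteq> 0"
    proof
      assume \<Delta>: "\<Delta> = 0"
      have "v \<noteq> 0"
        using ind dependent_zero by auto
      have rel: "v1 *\<^sub>R u = u1 *\<^sub>R v" "v2 *\<^sub>R u = u2 *\<^sub>R v"
        using \<Delta> by (auto simp: u12 v12 \<Delta>_def mult.commute)
      have "u \<in> span {v}"
      proof (cases "v1 = 0")
        case False
        then have "u = (u1 / v1) *\<^sub>R v"
          using rel(1) by (metis divideR_right scaleR_scaleR divide_inverse mult.commute)
        then show ?thesis
          by (metis span_base span_scale singletonI)
      next
        case True
        then have "v2 \<noteq> 0"
          using \<open>v \<noteq> 0\<close> by (auto simp: v12 zero_prod_def)
        then have "u = (u2 / v2) *\<^sub>R v"
          using rel(2) by (metis divideR_right scaleR_scaleR divide_inverse mult.commute)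
        then show ?thesis
          by (metis span_base span_scale singletonI)
      qed
      then show False
        using ind uv by (auto simp: independent_insert)
    qed
    have e: "(M + \<beta>) * u2 = a * u1 + c * v1" "(M - \<beta>) * u1 = a * u2 + c * v2"
      "(M + \<beta>) * v2 = b * u1 + d * v1" "(M - \<beta>) * v1 = b * u2 + d * v2"
      using u v by (auto simp: u12 v12 pole_matrix_def)
    \<comment> \<open>With A the matrix, this is det (A u, v) + det (u, A v) = tr A * det (u, v);
      the next identity is det (A u, A v) = det A * det (u, v).\<close>
    have "(a + d) * \<Delta> = 0"
      using e unfolding \<Delta>_def by algebra
    moreover have "(a * d - b * c) * \<Delta> = (\<beta>\<^sup>2 - M\<^sup>2) * \<Delta>"
      using e unfolding \<Delta>_def by algebra
    ultimately show ?thesis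
      using \<open>\<Delta> \<noteq> 0\<close> by simp
  qed
  moreover have "pole_matrix \<beta> M ` ?T \<subseteq> ?T"
    by (auto simp: pole_matrix_def)
  moreover have "pole_matrix \<beta> M (u + v) = pole_matrix \<beta> M u + pole_matrix \<beta> M v"
    "pole_matrix \<beta> M (r *\<^sub>R u) = r *\<^sub>R pole_matrix \<beta> M u" for u v r
    by (auto simp: pole_matrix_def algebra_simps)
  ultimately show ?thesis
    unfolding has_charpoly2_def by blast
qed

section \<open>Stability and instability\<close>

lemma flow_components:
  obtains x y z where "\<And>t. flow \<beta> t p = (x t, y t, z t)"
    "\<And>t. (x has_real_derivative y t * z t + \<beta> * y t) (at t)"
    "\<And>t. (y has_real_derivative x t * z t - \<beta> * x t) (at t)"
    "\<And>t. (z has_real_derivative - x t * y t) (at t)"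
proof -
  define x y z where "x t = fst (flow \<beta> t p)" and "y t = fst (snd (flow \<beta> t p))"
    and "z t = snd (snd (flow \<beta> t p))" for t
  have xyz: "flow \<beta> t p = (x t, y t, z t)" for t
    by (simp add: x_def y_def z_def)
  note d = vector_derivative_components[OF flow_has_vector_derivative[of \<beta> p, unfolded xyz Xb_simp],
      folded has_real_derivative_iff_has_vector_derivative, unfolded fst_conv snd_conv]
  show ?thesis
    using that[OF xyz d] .
qed

section \<open>Instability for |\<beta>| < |M|\<close>

lemma SigmaM_iff: "(x, y, z) \<in> SigmaM M \<longleftrightarrow> x\<^sup>2 + y\<^sup>2 = 2 * (M\<^sup>2 - z\<^sup>2)"
  by (auto simp: SigmaM_def field_simps)

lemma SigmaM_abs_le: "(x, y, z) \<in> SigmaM M \<Longrightarrow> \<bar>z\<bar> \<le> \<bar>M\<bar>"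
  unfolding abs_le_square_iff SigmaM_iff
  using zero_le_power2[of x] zero_le_power2[of y] by argo

text \<open>An orbit staying close to the pole keeps M (z + \<beta>) and M (z - \<beta>) bounded
  below by a positive constant, which forces M x y to grow at least linearly once it is positive;
  but on the surface it is bounded.\<close>

lemma not_lyapunov_stable_pole:
  assumes "\<bar>\<beta>\<bar> < \<bar>M\<bar>"
  shows "\<not> lyapunov_stable_on \<beta> (SigmaM M) (0, 0, M)"
proof
  assume stable: "lyapunov_stable_on \<beta> (SigmaM M) (0, 0, M)"
  \<comment> \<open>Half the gap: within distance \<open>e\<close> of the pole, |M| - |\<beta>| is
    reduced by at most \<open>e\<close>, so \<open>e\<close> remains.\<close>
  define e where "e = (\<bar>M\<bar> - \<bar>\<beta>\<bar>) / 2"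
  have e: "e > 0" and M: "M \<noteq> 0"
    using assms by (auto simp: e_def)
  obtain d where d: "d > 0"
    "\<And>p t. p \<in> SigmaM M \<Longrightarrow> dist p (0, 0, M) < d \<Longrightarrow> t \<ge> 0 \<Longrightarrow> dist (flow \<beta> t p) (0, 0, M) < e"
    using stable e unfolding lyapunov_stable_on_def by metis
  define a where "a = min 1 (d / (4 * \<bar>M\<bar>))"
  have a: "0 < a" "a \<le> 1" "4 * (\<bar>M\<bar> * a) \<le> d"
    using d M by (auto simp: a_def min_def field_simps)
  have a2: "a\<^sup>2 \<le> a"
    using a by (simp add: power2_eq_square mult_left_le)
  \<comment> \<open>The signs are chosen so that M x y = |M| M^2 a^2 > 0 whatever the sign of M; the
    third coordinate puts the point on the surface, near (0, 0, M) rather than its antipode.\<close>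
  define p where "p = (\<bar>M\<bar> * a, M * a, M * sqrt (1 - a\<^sup>2))"
  have p: "p \<in> SigmaM M"
    using a a2 by (simp add: p_def SigmaM_iff power_mult_distrib algebra_simps)
  have "dist p (0, 0, M) < d"
  proof -
    have "1 - a \<le> 1 - a\<^sup>2"
      using a2 by simp
    also have "\<dots> \<le> sqrt (1 - a\<^sup>2)"
      using a a2 by (intro real_le_rsqrt) (simp add: power2_eq_square[of "1 - _"] mult_left_le)
    finally have "1 - sqrt (1 - a\<^sup>2) \<le> a"
      by simp
    moreover have "sqrt (1 - a\<^sup>2) \<le> 1"
      by simp
    ultimately have "\<bar>sqrt (1 - a\<^sup>2) - 1\<bar> \<le> a"
      by linarith
    then have "\<bar>M\<bar> * \<bar>sqrt (1 - a\<^sup>2) - 1\<bar> \<le> \<bar>M\<bar> * a"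
      by (intro mult_left_mono) auto
    then have "\<bar>M * sqrt (1 - a\<^sup>2) - M\<bar> \<le> \<bar>M\<bar> * a"
      unfolding abs_mult[symmetric] right_diff_distrib mult_1_right .
    moreover have "dist p (0, 0, M) \<le> \<bar>\<bar>M\<bar> * a\<bar> + \<bar>M * a\<bar> + \<bar>M * sqrt (1 - a\<^sup>2) - M\<bar>"
      unfolding p_def dist_norm diff_Pair diff_zero by (rule norm_triple_le)
    ultimately have "dist p (0, 0, M) \<le> 3 * (\<bar>M\<bar> * a)"
      using a by (simp add: abs_mult mult.commute[of a])
    also have "\<dots> < 4 * (\<bar>M\<bar> * a)"
      using a M by simp
    finally show ?thesis
      using a by simp
  qed
  obtain x y z where xyz: "\<And>t. flow \<beta> t p = (x t, y t, z t)"
    and x': "\<And>t. (x has_real_derivative y t * z t + \<beta> * y t) (at t)"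
    and y': "\<And>t. (y has_real_derivative x t * z t - \<beta> * x t) (at t)"
    and "\<And>t. (z has_real_derivative - x t * y t) (at t)"
    using flow_components[of \<beta> p] by blast
  have z: "\<bar>z t - M\<bar> < e" if "t \<ge> 0" for t
    using d(2)[OF p \<open>dist p (0, 0, M) < d\<close> that]
      abs_le_norm_triple(3)[where x="x t" and y="y t" and z="z t - M"]
    by (simp add: xyz dist_norm)
  define V where "V t = M * (x t * y t)" for t
  have V_le: "2 * \<bar>V t\<bar> \<le> \<bar>M\<bar> * ((x t)\<^sup>2 + (y t)\<^sup>2)" for t
  proof -
    have "0 \<le> (\<bar>x t\<bar> - \<bar>y t\<bar>)\<^sup>2"
      by simp
    then have "2 * \<bar>x t * y t\<bar> \<le> (x t)\<^sup>2 + (y t)\<^sup>2"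
      by (simp add: power2_diff abs_mult)
    then have "\<bar>M\<bar> * (2 * \<bar>x t * y t\<bar>) \<le> \<bar>M\<bar> * ((x t)\<^sup>2 + (y t)\<^sup>2)"
      by (rule mult_left_mono) simp
    then show ?thesis
      by (simp add: V_def abs_mult)
  qed
  define V' where "V' t = (y t)\<^sup>2 * (M * (z t + \<beta>)) + (x t)\<^sup>2 * (M * (z t - \<beta>))" for t
  have V': "(V has_real_derivative V' t) (at t)" for t
    unfolding V_def V'_def
    by (auto intro!: derivative_eq_intros x'[THEN DERIV_cong] y'[THEN DERIV_cong]
        simp: power2_eq_square algebra_simps)
  have V'_ge: "V' t \<ge> 2 * e * \<bar>V t\<bar>" if "t \<ge> 0" for t
  proof -
    have lower: "\<bar>M\<bar> * e \<le> M * (z t + r)" if "\<bar>r\<bar> = \<bar>\<beta>\<bar>" for r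
    proof -
      have "M * (M - z t - r) \<le> \<bar>M\<bar> * \<bar>M - z t - r\<bar>"
        by (metis abs_ge_self abs_mult)
      also have "\<dots> \<le> \<bar>M\<bar> * (e + \<bar>\<beta>\<bar>)"
        using z[OF \<open>t \<ge> 0\<close>] \<open>\<bar>r\<bar> = \<bar>\<beta>\<bar>\<close> by (intro mult_left_mono) auto
      also have "\<dots> = M * M - \<bar>M\<bar> * e"
      proof -
        have "e + \<bar>\<beta>\<bar> = \<bar>M\<bar> - e"
          by (simp add: e_def field_simps)
        then show ?thesis
          by (simp only: right_diff_distrib abs_mult_self_eq)
      qed
      finally show ?thesis
        by (simp add: algebra_simps)
    qed
    have "(y t)\<^sup>2 * (\<bar>M\<bar> * e) + (x t)\<^sup>2 * (\<bar>M\<bar> * e) \<le> V' t"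
      unfolding V'_def using lower[of \<beta>] lower[of "- \<beta>"] by (intro add_mono mult_left_mono) auto
    moreover have "e * (2 * \<bar>V t\<bar>) \<le> e * (\<bar>M\<bar> * ((x t)\<^sup>2 + (y t)\<^sup>2))"
      using V_le e by (intro mult_left_mono) auto
    ultimately show ?thesis
      by (simp add: algebra_simps)
  qed
  have V0: "V 0 > 0"
  proof -
    have "V 0 = \<bar>M\<bar> * (M * M) * (a * a)"
      using xyz[of 0] by (auto simp: V_def p_def mult_ac)
    then show ?thesis
      using a M by (auto simp: zero_less_mult_iff)
  qed
  have V_mono: "V 0 \<le> V t" if "t \<ge> 0" for t
  proof (rule DERIV_nonneg_imp_nondecreasing[OF that])
    fix s :: real assume "0 \<le> s"
    then show "\<exists>r. (V has_real_derivative r) (at s) \<and> 0 \<le> r"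
      using V' V'_ge[of s] e by (meson abs_ge_zero mult_nonneg_nonneg order_trans less_imp_le zero_le_numeral)
  qed
  \<comment> \<open>At this time the linear lower bound has risen by |M| M^2, the maximum that the
    surface allows, on top of a positive initial value.\<close>
  define t where "t = \<bar>M\<bar> * M\<^sup>2 / (2 * e * V 0)"
  have t: "t \<ge> 0"
    using e V0 by (simp add: t_def)
  have "V 0 - 2 * e * V 0 * 0 \<le> V t - 2 * e * V 0 * t"
  proof (rule DERIV_nonneg_imp_nondecreasing[OF t])
    fix s :: real assume s: "0 \<le> s"
    have "2 * e * V 0 \<le> 2 * e * \<bar>V s\<bar>"
      using V_mono[OF s] e by (intro mult_left_mono) auto
    then have "2 * e * V 0 \<le> V' s"
      using V'_ge[OF s] by linarith
    moreover have "((\<lambda>t. V t - 2 * e * V 0 * t) has_real_derivative V' s - 2 * e * V 0) (at s)"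
      using V'[of s] by (auto intro!: derivative_eq_intros)
    ultimately show "\<exists>r. ((\<lambda>t. V t - 2 * e * V 0 * t) has_real_derivative r) (at s) \<and> 0 \<le> r"
      by (meson diff_ge_0_iff_ge)
  qed
  moreover have "2 * e * V 0 * t = \<bar>M\<bar> * M\<^sup>2"
    using e V0 by (simp add: t_def)
  moreover have "2 * \<bar>V t\<bar> \<le> 2 * (\<bar>M\<bar> * M\<^sup>2)"
  proof -
    have "(x t)\<^sup>2 + (y t)\<^sup>2 \<le> 2 * M\<^sup>2"
      using flow_in_SigmaM[OF p, of \<beta> t] by (simp add: xyz SigmaM_iff)
    then have "\<bar>M\<bar> * ((x t)\<^sup>2 + (y t)\<^sup>2) \<le> \<bar>M\<bar> * (2 * M\<^sup>2)"
      by (intro mult_left_mono) auto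
    then show ?thesis
      using V_le[of t] by simp
  qed
  ultimately show False
    using V0 by simp
qed

section \<open>Lyapunov stability for |M| < |\<beta>|\<close>

text \<open>Besides the energy, \<open>(x\<^sup>2 - y\<^sup>2) / 2 + 2 * \<beta> * z\<close> is conserved; the shift and the factor
  \<open>\<beta> * M\<close> make it vanish at the pole \<open>(0, 0, M)\<close> and be positive elsewhere on the surface.\<close>
definition lyap :: "real \<Rightarrow> real \<Rightarrow> pt \<Rightarrow> real" where
  "lyap \<beta> M p = (case p of (x, y, z) \<Rightarrow> \<beta> * M * (2 * \<beta> * M - ((x\<^sup>2 - y\<^sup>2) / 2 + 2 * \<beta> * z)))"

lemma lyap_flow [simp]: "lyap \<beta> M (flow \<beta> t p) = lyap \<beta> M p"
proof -
  obtain x y z where xyz: "\<And>t. flow \<beta> t p = (x t, y t, z t)"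
    and d: "\<And>t. (x has_real_derivative y t * z t + \<beta> * y t) (at t)"
      "\<And>t. (y has_real_derivative x t * z t - \<beta> * x t) (at t)"
      "\<And>t. (z has_real_derivative - x t * y t) (at t)"
    using flow_components[of \<beta> p] by blast
  have "((\<lambda>t. lyap \<beta> M (flow \<beta> t p)) has_real_derivative 0) (at t)" for t
    unfolding xyz lyap_def prod.case
    by (rule derivative_eq_intros d refl | simp add: algebra_simps)+
  then show ?thesis
    using DERIV_zero_imp_eq[of "\<lambda>t. lyap \<beta> M (flow \<beta> t p)" t 0] by simp
qed

lemma continuous_on_lyap: "continuous_on S (lyap \<beta> M)"
  unfolding lyap_def case_prod_beta by (intro continuous_intros) auto

lemma lyap_pole [simp]: "lyap \<beta> M (0, 0, M) = 0"
  by (simp add: lyap_def)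

text \<open>On the surface D = M (M - z) controls everything: the squared distance is at most 4 D,
  and |x^2 - y^2| / 2 is at most 2 D. Hence the term 2 \<beta>^2 D of \<open>lyap\<close> outweighs
  the indefinite one, and 2 |\<beta>| (|\<beta>| - |M|) D remains.\<close>

lemma dist_pole_le_lyap:
  assumes "p \<in> SigmaM M" "\<bar>M\<bar> < \<bar>\<beta>\<bar>"
  shows "\<bar>\<beta>\<bar> * (\<bar>\<beta>\<bar> - \<bar>M\<bar>) * (dist p (0, 0, M))\<^sup>2 \<le> 2 * lyap \<beta> M p"
proof -
  obtain x y z where p: "p = (x, y, z)" by (cases p)
  have S: "x\<^sup>2 + y\<^sup>2 = 2 * (M\<^sup>2 - z\<^sup>2)"
    using assms by (simp add: p SigmaM_iff)
  define D where "D = M * (M - z)"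
  have D: "M\<^sup>2 - z\<^sup>2 \<le> 2 * D"
    using zero_le_power2[of "M - z"] unfolding D_def power2_diff by (simp add: power2_eq_square algebra_simps)
  have "(dist p (0, 0, M))\<^sup>2 = x\<^sup>2 + y\<^sup>2 + (z - M)\<^sup>2"
    by (simp add: p dist_norm norm_triple_squared)
  also have "\<dots> \<le> 4 * D"
    using S zero_le_power2[of "M - z"] unfolding D_def power2_diff
    by (simp add: power2_eq_square algebra_simps)
  finally have "\<bar>\<beta>\<bar> * (\<bar>\<beta>\<bar> - \<bar>M\<bar>) * (dist p (0, 0, M))\<^sup>2 \<le> \<bar>\<beta>\<bar> * (\<bar>\<beta>\<bar> - \<bar>M\<bar>) * (4 * D)"
    using assms(2) by (intro mult_left_mono) auto
  moreover have "\<beta> * M * ((x\<^sup>2 - y\<^sup>2) / 2) \<le> 2 * (\<bar>\<beta>\<bar> * \<bar>M\<bar>) * D"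
  proof -
    have "\<beta> * M * ((x\<^sup>2 - y\<^sup>2) / 2) \<le> \<bar>\<beta> * M\<bar> * \<bar>(x\<^sup>2 - y\<^sup>2) / 2\<bar>"
      by (metis abs_ge_self abs_mult)
    also have "\<dots> \<le> \<bar>\<beta> * M\<bar> * (M\<^sup>2 - z\<^sup>2)"
    proof (intro mult_left_mono)
      show "\<bar>(x\<^sup>2 - y\<^sup>2) / 2\<bar> \<le> M\<^sup>2 - z\<^sup>2"
        using S zero_le_power2[of x] zero_le_power2[of y] unfolding abs_le_iff by argo
    qed simp
    also have "\<dots> \<le> \<bar>\<beta> * M\<bar> * (2 * D)"
      using D by (intro mult_left_mono) auto
    finally show ?thesis
      by (simp add: abs_mult)
  qed
  moreover have "lyap \<beta> M p = 2 * (\<bar>\<beta>\<bar> * \<bar>\<beta>\<bar>) * D - \<beta> * M * ((x\<^sup>2 - y\<^sup>2) / 2)"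
    unfolding p lyap_def D_def prod.case abs_mult_self_eq by (simp add: field_simps)
  moreover have "\<bar>\<beta>\<bar> * (\<bar>\<beta>\<bar> - \<bar>M\<bar>) * (4 * D) = 2 * (2 * (\<bar>\<beta>\<bar> * \<bar>\<beta>\<bar>) * D - 2 * (\<bar>\<beta>\<bar> * \<bar>M\<bar>) * D)"
    by (simp add: algebra_simps)
  ultimately show ?thesis
    by argo
qed

text \<open>Since \<open>lyap\<close> is constant along the orbit, its initial value bounds the
  distance at all times. This yields both the stability and the shrinking of the periodic
  orbits.\<close>

lemma orbit_dist_pole_le:
  assumes "p \<in> SigmaM M" "\<bar>M\<bar> < \<bar>\<beta>\<bar>" "q \<in> orbit \<beta> p"
  shows "dist q (0, 0, M) \<le> sqrt (2 * lyap \<beta> M p / (\<bar>\<beta>\<bar> * (\<bar>\<beta>\<bar> - \<bar>M\<bar>)))"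
proof -
  obtain t where q: "q = flow \<beta> t p"
    using assms(3) by (auto simp: orbit_def)
  have "\<bar>\<beta>\<bar> * (\<bar>\<beta>\<bar> - \<bar>M\<bar>) > 0"
    using assms(2) by (intro mult_pos_pos) auto
  moreover have "\<bar>\<beta>\<bar> * (\<bar>\<beta>\<bar> - \<bar>M\<bar>) * (dist q (0, 0, M))\<^sup>2 \<le> 2 * lyap \<beta> M p"
    using dist_pole_le_lyap[OF flow_in_SigmaM[OF assms(1), of \<beta> t] assms(2)] by (simp add: q)
  ultimately show ?thesis
    by (intro real_le_rsqrt) (simp add: pos_le_divide_eq mult.commute)
qed

lemma lyapunov_stable_pole:
  assumes "\<bar>M\<bar> < \<bar>\<beta>\<bar>"
  shows "lyapunov_stable_on \<beta> (SigmaM M) (0, 0, M)"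
  unfolding lyapunov_stable_on_def
proof (intro allI impI)
  fix e :: real assume e: "e > 0"
  define f where "f p = sqrt (2 * lyap \<beta> M p / (\<bar>\<beta>\<bar> * (\<bar>\<beta>\<bar> - \<bar>M\<bar>)))" for p
  have "continuous_on UNIV f"
    unfolding f_def using assms by (intro continuous_intros continuous_on_lyap) auto
  moreover have "f (0, 0, M) = 0"
    by (simp add: f_def)
  ultimately obtain d where d: "d > 0" "\<And>p. dist p (0, 0, M) < d \<Longrightarrow> f p < e"
    using e unfolding continuous_on_iff dist_real_def
    by (metis UNIV_I abs_less_iff diff_zero)
  have "dist (flow \<beta> t p) (0, 0, M) < e" if "p \<in> SigmaM M" "dist p (0, 0, M) < d" for p t
    using orbit_dist_pole_le[OF that(1) assms, of "flow \<beta> t p"] d(2)[OF that(2)]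
    by (simp add: f_def orbit_def)
  then show "\<exists>d>0. \<forall>p\<in>SigmaM M. dist p (0, 0, M) < d \<longrightarrow> (\<forall>t\<ge>0. dist (flow \<beta> t p) (0, 0, M) < e)"
    using d(1) by blast
qed

section \<open>Periodic orbits around the pole\<close>

text \<open>No branch of the argument is chosen: the angle is the integral of the angular velocity,
  and only afterwards shown to be a polar angle of the curve. It is measured clockwise, so that it
  increases when \<open>P\<close> and \<open>Q\<close> are positive.\<close>

lemma polar_lift:
  fixes X Y P Q :: "real \<Rightarrow> real"
  assumes X': "\<And>t. (X has_real_derivative P t * Y t) (at t)"
    and Y': "\<And>t. (Y has_real_derivative - Q t * X t) (at t)"
    and cont: "continuous_on UNIV P" "continuous_on UNIV Q"
    and nz: "\<And>t. (X t)\<^sup>2 + (Y t)\<^sup>2 > 0"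
    and init: "X 0 = \<rho>\<^sub>0 * cos \<psi>\<^sub>0" "Y 0 = - \<rho>\<^sub>0 * sin \<psi>\<^sub>0" "\<rho>\<^sub>0 > 0"
  shows "\<exists>\<psi>. \<psi> 0 = \<psi>\<^sub>0 \<and>
    (\<forall>t. (\<psi> has_real_derivative (Q t * (X t)\<^sup>2 + P t * (Y t)\<^sup>2) / ((X t)\<^sup>2 + (Y t)\<^sup>2)) (at t)) \<and>
    (\<forall>t. \<exists>r>0. X t = r * cos (\<psi> t) \<and> Y t = - r * sin (\<psi> t))"
proof -
  define N where "N t = (X t)\<^sup>2 + (Y t)\<^sup>2" for t
  define g where "g t = (Q t * (X t)\<^sup>2 + P t * (Y t)\<^sup>2) / N t" for t
  have N: "N t > 0" for t
    using nz by (simp add: N_def)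
  have contXY: "continuous_on UNIV X" "continuous_on UNIV Y"
    by (intro continuous_at_imp_continuous_on ballI DERIV_isCont[OF X'] DERIV_isCont[OF Y'])+
  have "continuous_on UNIV g"
    unfolding g_def N_def
    by (intro continuous_intros cont contXY ballI) (metis nz less_irrefl)
  then obtain G where G: "G 0 = 0" "\<And>t. (G has_vector_derivative g t) (at t)"
    using continuous_antiderivative_real by blast
  define \<psi> where "\<psi> t = \<psi>\<^sub>0 + G t" for t
  have \<psi>': "(\<psi> has_real_derivative g t) (at t)" for t
    unfolding \<psi>_def using G(2)[of t]
    by (auto intro!: derivative_eq_intros simp: has_real_derivative_iff_has_vector_derivative)
  have \<psi>0: "\<psi> 0 = \<psi>\<^sub>0"
    by (simp add: \<psi>_def G(1))
  define \<rho> where "\<rho> t = sqrt (N t)" for t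
  have \<rho>: "\<rho> t > 0" "(\<rho> t)\<^sup>2 = N t" for t
    using N[of t] by (auto simp: \<rho>_def less_imp_le)
  \<comment> \<open>The logarithmic derivative of the radius.\<close>
  define \<mu> where "\<mu> t = (P t - Q t) * X t * Y t / N t" for t
  \<comment> \<open>The components of (X, Y) along and across the direction predicted by
    \<open>\<psi>\<close>. Both satisfy the linear equation of the radius, so their ratios to it
    keep the initial values 1 and 0.\<close>
  define u v where "u t = X t * cos (\<psi> t) - Y t * sin (\<psi> t)"
    and "v t = X t * sin (\<psi> t) + Y t * cos (\<psi> t)" for t
  have Pg: "P t - g t = (P t - Q t) * (X t)\<^sup>2 / N t" and Qg: "g t - Q t = (P t - Q t) * (Y t)\<^sup>2 / N t" for t
    using N[of t] by (auto simp: g_def field_simps) (auto simp: N_def algebra_simps)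
  have \<rho>': "(\<rho> has_real_derivative \<mu> t * \<rho> t) (at t)" for t
  proof -
    have "(N has_real_derivative 2 * ((P t - Q t) * X t * Y t)) (at t)"
      unfolding N_def
      by (rule derivative_eq_intros X' Y' refl)+ (simp add: algebra_simps)
    also have "(P t - Q t) * X t * Y t = \<mu> t * N t"
      using N[of t] by (simp add: \<mu>_def)
    finally have "(\<rho> has_real_derivative inverse (sqrt (N t)) / 2 * (2 * (\<mu> t * N t))) (at t)"
      unfolding \<rho>_def using N by (intro DERIV_chain2[OF DERIV_real_sqrt])
    also have "inverse (sqrt (N t)) / 2 * (2 * (\<mu> t * N t)) = \<mu> t * \<rho> t"
      using \<rho>[of t] by (simp add: \<rho>_def[symmetric] power2_eq_square field_simps flip: \<rho>(2))
    finally show ?thesis .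
  qed
  have v': "(v has_real_derivative \<mu> t * v t) (at t)" for t
  proof -
    have "(v has_real_derivative (P t - g t) * Y t * sin (\<psi> t) + (g t - Q t) * X t * cos (\<psi> t)) (at t)"
      unfolding v_def
      by (rule derivative_eq_intros X' Y' \<psi>' refl)+ (simp add: algebra_simps)
    also have "(P t - g t) * Y t * sin (\<psi> t) + (g t - Q t) * X t * cos (\<psi> t) = \<mu> t * v t"
      unfolding Pg Qg \<mu>_def v_def using N[of t] by (simp add: field_simps power2_eq_square)
    finally show ?thesis .
  qed
  have u': "(u has_real_derivative \<mu> t * u t) (at t)" for t
  proof -
    have "(u has_real_derivative (P t - g t) * Y t * cos (\<psi> t) - (g t - Q t) * X t * sin (\<psi> t)) (at t)"
      unfolding u_def
      by (rule derivative_eq_intros X' Y' \<psi>' refl)+ (simp add: algebra_simps)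
    also have "(P t - g t) * Y t * cos (\<psi> t) - (g t - Q t) * X t * sin (\<psi> t) = \<mu> t * u t"
      unfolding Pg Qg \<mu>_def u_def using N[of t] by (simp add: field_simps power2_eq_square)
    finally show ?thesis .
  qed
  have ratio: "w t / \<rho> t = w 0 / \<rho> 0" if "\<And>t. (w has_real_derivative \<mu> t * w t) (at t)" for w t
  proof -
    have "((\<lambda>t. w t / \<rho> t) has_real_derivative 0) (at t)" for t
      using \<rho>[of t] by (auto intro!: derivative_eq_intros that \<rho>'[THEN DERIV_cong])
    then show ?thesis
      by (rule DERIV_zero_imp_eq)
  qed
  have "N 0 = \<rho>\<^sub>0\<^sup>2 * ((cos \<psi>\<^sub>0)\<^sup>2 + (sin \<psi>\<^sub>0)\<^sup>2)"
    unfolding N_def init by (simp only: power_mult_distrib distrib_left power2_minus)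
  then have "\<rho> 0 = \<rho>\<^sub>0"
    using init(3) by (simp add: \<rho>_def)
  moreover have "u 0 = \<rho>\<^sub>0 * ((cos \<psi>\<^sub>0)\<^sup>2 + (sin \<psi>\<^sub>0)\<^sup>2)" "v 0 = 0"
    unfolding u_def v_def \<psi>0 init by algebra+
  ultimately have u: "u t = \<rho> t" and v: "v t = 0" for t
    using ratio[OF u', of t] ratio[OF v', of t] \<rho>(1)[of t] init(3) by auto
  have "X t = \<rho> t * cos (\<psi> t) \<and> Y t = - \<rho> t * sin (\<psi> t)" for t
  proof -
    have "X t * ((cos (\<psi> t))\<^sup>2 + (sin (\<psi> t))\<^sup>2) = u t * cos (\<psi> t) + v t * sin (\<psi> t)"
      "Y t * ((cos (\<psi> t))\<^sup>2 + (sin (\<psi> t))\<^sup>2) = - u t * sin (\<psi> t) + v t * cos (\<psi> t)"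
      unfolding u_def v_def by algebra+
    then show ?thesis
      by (simp add: u v)
  qed
  then show ?thesis
    using \<psi>0 \<psi>'[unfolded g_def N_def] \<rho>(1) by blast
qed

lemma derivative_ge_reaches:
  fixes \<psi> :: "real \<Rightarrow> real"
  assumes \<psi>': "\<And>t. (\<psi> has_real_derivative \<psi>' t) (at t)" and c: "c > 0" "\<And>t. c \<le> \<psi>' t"
    and "\<psi> 0 < L"
  shows "\<exists>t>0. \<psi> t = L"
proof -
  define b where "b = (L - \<psi> 0) / c"
  have b: "b > 0"
    using assms by (simp add: b_def)
  obtain \<xi> where "\<psi> b - \<psi> 0 = (b - 0) * \<psi>' \<xi>"
    using MVT2[OF b, of \<psi> \<psi>'] \<psi>' by auto
  moreover have "b * c \<le> b * \<psi>' \<xi>"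
    using b c(2)[of \<xi>] by (intro mult_left_mono) auto
  moreover have "b * c = L - \<psi> 0"
    using c by (simp add: b_def)
  ultimately have "L \<le> \<psi> b"
    by simp
  moreover have "continuous_on {0..b} \<psi>"
    by (intro continuous_at_imp_continuous_on ballI DERIV_isCont[OF \<psi>'])
  ultimately obtain t where "0 \<le> t" "t \<le> b" "\<psi> t = L"
    using IVT'[of \<psi> 0 L b] assms(4) b by auto
  then show ?thesis
    using assms(4) by (metis less_eq_real_def less_irrefl)
qed

section \<open>Rotation of the flow around an elliptic pole\<close>

locale elliptic_pole =
  fixes \<beta> M :: real
  assumes M_nz: "M \<noteq> 0" and M_less: "\<bar>M\<bar> < \<bar>\<beta>\<bar>"
begin

text \<open>The sense of rotation changes with the sign of \<beta>; reflecting y by \<open>s\<close>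
  makes the angle increase in both cases.\<close>

definition s where "s = sgn \<beta>"
text \<open>\<open>a\<close> and \<open>b\<close> are proportional to the half-axes of the ellipses
  on which the linearized flow moves.\<close>

definition a where "a = sqrt (\<bar>\<beta>\<bar> + s * M)"
definition b where "b = sqrt (\<bar>\<beta>\<bar> - s * M)"
definition \<omega> where "\<omega> = sqrt (\<beta>\<^sup>2 - M\<^sup>2)"
text \<open>A bound for the rate at which the angular velocity can leave \<open>\<omega>\<close> as
  z leaves M: the ratios b / a and a / b occur on the two axes, and their sum covers both.\<close>

definition K where "K = a / b + b / a"

lemma s_simps: "s * s = 1" "s * \<beta> = \<bar>\<beta>\<bar>" "\<bar>s * z\<bar> = \<bar>z\<bar>"
  using M_less by (auto simp: s_def abs_mult sgn_mult_self_eq sgn_if)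

lemma weights: "a > 0" "b > 0" "a * a = \<bar>\<beta>\<bar> + s * M" "b * b = \<bar>\<beta>\<bar> - s * M" "a * b = \<omega>" "\<omega> > 0" "K > 0"
proof -
  have pos: "\<bar>\<beta>\<bar> + s * M > 0" "\<bar>\<beta>\<bar> - s * M > 0"
    using s_simps(3)[of M] M_less by linarith+
  then show ab: "a > 0" "b > 0" "a * a = \<bar>\<beta>\<bar> + s * M" "b * b = \<bar>\<beta>\<bar> - s * M"
    by (auto simp: a_def b_def)
  have "a * b = sqrt ((\<bar>\<beta>\<bar> + s * M) * (\<bar>\<beta>\<bar> - s * M))"
    by (simp add: a_def b_def real_sqrt_mult)
  also have "(\<bar>\<beta>\<bar> + s * M) * (\<bar>\<beta>\<bar> - s * M) = \<bar>\<beta>\<bar> * \<bar>\<beta>\<bar> - (s * s) * (M * M)"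
    by (simp add: algebra_simps)
  also have "\<dots> = \<beta>\<^sup>2 - M\<^sup>2"
    by (simp add: s_simps power2_eq_square)
  finally show "a * b = \<omega>"
    by (simp add: \<omega>_def)
  then show "\<omega> > 0"
    using ab mult_pos_pos by metis
  show "K > 0"
    using ab by (simp add: K_def add_pos_pos)
qed

text \<open>In the coordinates \<open>X = x / a\<close>, \<open>Y = s * y / b\<close> the linearization is the rotation with
  angular velocity \<open>\<omega>\<close>; on the surface, where \<open>\<bar>z\<bar> \<le> \<bar>M\<bar> < \<bar>\<beta>\<bar>\<close>, the nonlinear flow still
  rotates with positive angular velocity, and uniformly close to \<open>\<omega>\<close> where \<open>z\<close> is close
  to \<open>M\<close>.\<close>
lemma flow_rotation:
  assumes p: "p \<in> SigmaM M" "p = (x\<^sub>0, y\<^sub>0, z\<^sub>0)"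
    and init: "x\<^sub>0 = \<rho>\<^sub>0 * a * cos \<psi>\<^sub>0" "y\<^sub>0 = - s * \<rho>\<^sub>0 * b * sin \<psi>\<^sub>0" "\<rho>\<^sub>0 > 0"
  obtains \<psi> \<psi>' c where "\<psi> 0 = \<psi>\<^sub>0" "\<And>t. (\<psi> has_real_derivative \<psi>' t) (at t)"
    "c > 0" "\<And>t. c \<le> \<psi>' t"
    "\<And>\<eta> t. (\<And>t. \<bar>snd (snd (flow \<beta> t p)) - M\<bar> \<le> \<eta>) \<Longrightarrow> \<bar>\<psi>' t - \<omega>\<bar> \<le> K * \<eta>"
    "\<And>t. \<exists>r>0. fst (flow \<beta> t p) = r * a * cos (\<psi> t) \<and> fst (snd (flow \<beta> t p)) = - s * r * b * sin (\<psi> t)"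
proof -
  obtain x y z where xyz: "\<And>t. flow \<beta> t p = (x t, y t, z t)"
    and x': "\<And>t. (x has_real_derivative y t * z t + \<beta> * y t) (at t)"
    and y': "\<And>t. (y has_real_derivative x t * z t - \<beta> * x t) (at t)"
    and z': "\<And>t. (z has_real_derivative - x t * y t) (at t)"
    using flow_components[of \<beta> p] by blast
  note ab = weights(1,2)
  define P where "P t = b / a * (\<bar>\<beta>\<bar> + s * z t)" for t
  define Q where "Q t = a / b * (\<bar>\<beta>\<bar> - s * z t)" for t
  define X where "X t = x t / a" for t
  define Y where "Y t = s * y t / b" for t
  have X': "(X has_real_derivative P t * Y t) (at t)" for t
  proof -
    have "P t * Y t = (s * s) * (z t * y t) / a + (s * \<bar>\<beta>\<bar>) * y t / a"
      using ab by (simp add: P_def Y_def field_simps)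
    also have "s * \<bar>\<beta>\<bar> = \<beta>"
      using s_simps by (metis mult.assoc mult_1)
    finally have "P t * Y t = (y t * z t + \<beta> * y t) / a"
      by (simp add: s_simps add_divide_distrib mult.commute)
    then show ?thesis
      unfolding X_def using x'[of t] ab by (auto intro!: derivative_eq_intros)
  qed
  have Y': "(Y has_real_derivative - Q t * X t) (at t)" for t
  proof -
    have "- Q t * X t = s * (x t * z t) / b - (s * \<beta>) * x t / b"
      using ab by (simp add: Q_def X_def field_simps flip: s_simps(2))
    then have "- Q t * X t = s * (x t * z t - \<beta> * x t) / b"
      by (simp add: diff_divide_distrib algebra_simps)
    then show ?thesis
      unfolding Y_def using y'[of t] ab by (auto intro!: derivative_eq_intros)
  qed
  have contz: "continuous_on UNIV z"
    by (intro continuous_at_imp_continuous_on ballI DERIV_isCont[OF z'])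
  have contPQ: "continuous_on UNIV P" "continuous_on UNIV Q"
    unfolding P_def Q_def by (intro continuous_intros contz)+
  have s_nz: "s \<noteq> 0"
    using s_simps(1) by auto
  have N: "(X t)\<^sup>2 + (Y t)\<^sup>2 > 0" for t
  proof -
    \<comment> \<open>The points of the z-axis are equilibria, so an orbit touching the axis would,
      followed backwards, have started there.\<close>
    have "x t \<noteq> 0 \<or> y t \<noteq> 0"
    proof (rule ccontr)
      assume "\<not> (x t \<noteq> 0 \<or> y t \<noteq> 0)"
      then have "flow \<beta> (- t) (flow \<beta> t p) = (0, 0, z t)"
        by (simp add: xyz)
      then have "x\<^sub>0 = 0" "y\<^sub>0 = 0"
        unfolding flow_add[symmetric] using p(2) by auto
      then have "cos \<psi>\<^sub>0 = 0" "sin \<psi>\<^sub>0 = 0"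
        using init ab s_nz by auto
      then show False
        using sin_cos_squared_add[of \<psi>\<^sub>0] by simp
    qed
    then show ?thesis
      using ab s_nz by (auto simp: X_def Y_def sum_power2_gt_zero_iff)
  qed
  have "X 0 = \<rho>\<^sub>0 * cos \<psi>\<^sub>0" "Y 0 = - (s * s) * \<rho>\<^sub>0 * sin \<psi>\<^sub>0"
  proof -
    have "x 0 = \<rho>\<^sub>0 * a * cos \<psi>\<^sub>0" "y 0 = - s * \<rho>\<^sub>0 * b * sin \<psi>\<^sub>0"
      using xyz[of 0] p(2) init by auto
    then show "X 0 = \<rho>\<^sub>0 * cos \<psi>\<^sub>0" "Y 0 = - (s * s) * \<rho>\<^sub>0 * sin \<psi>\<^sub>0"
      using ab by (simp_all add: X_def Y_def)
  qed
  then have "X 0 = \<rho>\<^sub>0 * cos \<psi>\<^sub>0" "Y 0 = - \<rho>\<^sub>0 * sin \<psi>\<^sub>0"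
    unfolding s_simps by simp_all
  from polar_lift[OF X' Y' contPQ N this init(3)]
  obtain \<psi> where \<psi>: "\<psi> 0 = \<psi>\<^sub>0"
    "\<And>t. (\<psi> has_real_derivative (Q t * (X t)\<^sup>2 + P t * (Y t)\<^sup>2) / ((X t)\<^sup>2 + (Y t)\<^sup>2)) (at t)"
    "\<And>t. \<exists>r>0. X t = r * cos (\<psi> t) \<and> Y t = - r * sin (\<psi> t)"
    by blast
  define \<psi>' where "\<psi>' t = (Q t * (X t)\<^sup>2 + P t * (Y t)\<^sup>2) / ((X t)\<^sup>2 + (Y t)\<^sup>2)" for t
  \<comment> \<open>The angular velocity is an average of \<open>P\<close> and \<open>Q\<close> with
    weights X^2 and Y^2, so common bounds of the two pass to it.\<close>
  have avg_ge: "l \<le> \<psi>' t" if "l \<le> P t" "l \<le> Q t" for l t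
    unfolding \<psi>'_def pos_le_divide_eq[OF N] distrib_left using that by (intro add_mono mult_right_mono) auto
  have avg_le: "\<psi>' t \<le> l" if "P t \<le> l" "Q t \<le> l" for l t
    unfolding \<psi>'_def pos_divide_le_eq[OF N] distrib_left using that by (intro add_mono mult_right_mono) auto
  have zM: "\<bar>z t\<bar> \<le> \<bar>M\<bar>" for t
    using flow_in_SigmaM[OF p(1), of \<beta> t] SigmaM_abs_le by (simp add: xyz)
  define c where "c = min (a / b) (b / a) * (\<bar>\<beta>\<bar> - \<bar>M\<bar>)"
  have "c > 0"
    using ab M_less by (simp add: c_def)
  moreover have "c \<le> \<psi>' t" for t
  proof (rule avg_ge)
    have "\<bar>\<beta>\<bar> - \<bar>M\<bar> \<le> \<bar>\<beta>\<bar> + s * z t" "\<bar>\<beta>\<bar> - \<bar>M\<bar> \<le> \<bar>\<beta>\<bar> - s * z t"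
      using zM[of t] s_simps(3)[of "z t"] by linarith+
    then show "c \<le> P t" "c \<le> Q t"
      unfolding c_def P_def Q_def using ab M_less by (intro mult_mono; simp)+
  qed
  moreover have "\<bar>\<psi>' t - \<omega>\<bar> \<le> K * \<eta>" if "\<And>t. \<bar>snd (snd (flow \<beta> t p)) - M\<bar> \<le> \<eta>" for \<eta> t
  proof -
    have \<eta>: "\<bar>s * (z t - M)\<bar> \<le> \<eta>"
      using that[of t] by (simp add: xyz s_simps)
    then have "\<eta> \<ge> 0"
      by linarith
    have "P t = b / a * (a * a + s * (z t - M))" "Q t = a / b * (b * b - s * (z t - M))"
      unfolding weights P_def Q_def by (simp_all add: algebra_simps)
    then have "P t - \<omega> = b / a * (s * (z t - M))" "Q t - \<omega> = - (a / b * (s * (z t - M)))"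
      unfolding weights(5)[symmetric] using ab by (simp_all add: field_simps)
    then have "\<bar>P t - \<omega>\<bar> = b / a * \<bar>s * (z t - M)\<bar>" "\<bar>Q t - \<omega>\<bar> = a / b * \<bar>s * (z t - M)\<bar>"
      using ab by (simp_all add: abs_mult)
    moreover have "b / a * \<bar>s * (z t - M)\<bar> \<le> K * \<eta>" "a / b * \<bar>s * (z t - M)\<bar> \<le> K * \<eta>"
      using \<eta> ab \<open>\<eta> \<ge> 0\<close> by (intro mult_mono; simp add: K_def)+
    ultimately have "\<bar>P t - \<omega>\<bar> \<le> K * \<eta>" "\<bar>Q t - \<omega>\<bar> \<le> K * \<eta>"
      by simp_all
    then show ?thesis
      using avg_ge[of "\<omega> - K * \<eta>" t] avg_le[of t "\<omega> + K * \<eta>"] by linarith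
  qed
  moreover have "\<exists>r>0. fst (flow \<beta> t p) = r * a * cos (\<psi> t) \<and> fst (snd (flow \<beta> t p)) = - s * r * b * sin (\<psi> t)" for t
  proof -
    obtain r where r: "r > 0" "X t = r * cos (\<psi> t)" "Y t = - r * sin (\<psi> t)"
      using \<psi>(3) by blast
    have "x t = a * X t" "y t = s * b * Y t"
      using ab s_simps(1) by (auto simp: X_def Y_def)
    then show ?thesis
      using r by (auto simp: xyz)
  qed
  ultimately show ?thesis
    using that[of \<psi> \<psi>' c] \<psi>(1) \<psi>(2)[folded \<psi>'_def] by blast
qed

text \<open>The parameter is 1 - z / M, running from the pole at 0 to the antipodal equilibrium at
  2. Being affine in z, it turns \<open>lyap\<close> into a quadratic polynomial.\<close>

definition meridian :: "real \<Rightarrow> pt" where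
  "meridian \<epsilon> = (\<bar>M\<bar> * sqrt (2 * \<epsilon> * (2 - \<epsilon>)), 0, M * (1 - \<epsilon>))"

lemma meridian_0 [simp]: "meridian 0 = (0, 0, M)"
  by (simp add: meridian_def)

lemma meridian_in_SigmaM: "\<epsilon> \<in> {0..2} \<Longrightarrow> meridian \<epsilon> \<in> SigmaM M"
  by (simp add: meridian_def SigmaM_iff power_mult_distrib) (simp add: power2_eq_square algebra_simps)

lemma continuous_on_meridian: "continuous_on S meridian"
  unfolding meridian_def by (intro continuous_intros)

lemma meridian_exhausts:
  assumes "(x, 0, z) \<in> SigmaM M" "x \<ge> 0"
  obtains \<epsilon> where "\<epsilon> \<in> {0..2}" "(x, 0, z) = meridian \<epsilon>"
proof
  define \<epsilon> where "\<epsilon> = 1 - z / M"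
  have "\<bar>z / M\<bar> \<le> 1"
    using SigmaM_abs_le[OF assms(1)] M_nz by (simp add: divide_le_eq)
  then show \<epsilon>: "\<epsilon> \<in> {0..2}"
    unfolding \<epsilon>_def abs_le_iff by auto
  have z: "z = M * (1 - \<epsilon>)"
    using M_nz by (simp add: \<epsilon>_def)
  have "x\<^sup>2 = 2 * (M\<^sup>2 - (M * (1 - \<epsilon>))\<^sup>2)"
    using assms(1) unfolding z[symmetric] by (simp add: SigmaM_iff)
  also have "\<dots> = M\<^sup>2 * (2 * \<epsilon> * (2 - \<epsilon>))"
    by (simp add: power2_eq_square algebra_simps)
  also have "\<dots> = (\<bar>M\<bar> * sqrt (2 * \<epsilon> * (2 - \<epsilon>)))\<^sup>2"
    using \<epsilon> by (simp add: power_mult_distrib)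
  finally have "x = \<bar>M\<bar> * sqrt (2 * \<epsilon> * (2 - \<epsilon>))"
    by (rule power2_eq_imp_eq) (use assms(2) \<epsilon> in simp_all)
  then show "(x, 0, z) = meridian \<epsilon>"
    by (simp add: meridian_def z)
qed

lemma lyap_meridian:
  "\<epsilon> \<in> {0..2} \<Longrightarrow> lyap \<beta> M (meridian \<epsilon>) = M\<^sup>2 * (\<epsilon> * (\<beta> * (2 * \<beta> - M * (2 - \<epsilon>))))"
  by (simp add: meridian_def lyap_def power_mult_distrib) (simp add: power2_eq_square algebra_simps)

text \<open>The difference quotient is M^2 \<beta> (2 \<beta> - M (2 - (\<epsilon> + \<delta>))),
  which is positive because |2 - (\<epsilon> + \<delta>)| is at most 2 and |M| < |\<beta>|.\<close>

lemma lyap_meridian_strict_mono: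
  assumes "\<epsilon> \<in> {0..2}" "\<delta> \<in> {0..2}" "\<epsilon> < \<delta>"
  shows "lyap \<beta> M (meridian \<epsilon>) < lyap \<beta> M (meridian \<delta>)"
proof -
  have "\<beta> * (M * (2 - (\<epsilon> + \<delta>))) \<le> \<bar>\<beta>\<bar> * (\<bar>M\<bar> * 2)"
  proof -
    have "\<beta> * (M * (2 - (\<epsilon> + \<delta>))) \<le> \<bar>\<beta>\<bar> * (\<bar>M\<bar> * \<bar>2 - (\<epsilon> + \<delta>)\<bar>)"
      by (metis abs_ge_self abs_mult)
    also have "\<dots> \<le> \<bar>\<beta>\<bar> * (\<bar>M\<bar> * 2)"
      using assms by (intro mult_left_mono) auto
    finally show ?thesis .
  qed
  also have "\<dots> < \<bar>\<beta>\<bar> * (\<bar>\<beta>\<bar> * 2)"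
    using M_less by (intro mult_strict_left_mono) auto
  finally have "\<beta> * (2 * \<beta> - M * (2 - (\<epsilon> + \<delta>))) > 0"
    by (simp add: algebra_simps)
  then have "M\<^sup>2 * ((\<delta> - \<epsilon>) * (\<beta> * (2 * \<beta> - M * (2 - (\<epsilon> + \<delta>))))) > 0"
    using M_nz assms(3) by simp
  also have "M\<^sup>2 * ((\<delta> - \<epsilon>) * (\<beta> * (2 * \<beta> - M * (2 - (\<epsilon> + \<delta>)))))
      = lyap \<beta> M (meridian \<delta>) - lyap \<beta> M (meridian \<epsilon>)"
    unfolding lyap_meridian[OF assms(1)] lyap_meridian[OF assms(2)] by (simp add: algebra_simps)
  finally show ?thesis
    by simp
qed

lemma lyap_meridian_eq_iff:
  assumes "\<epsilon> \<in> {0..2}" "\<delta> \<in> {0..2}"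
  shows "lyap \<beta> M (meridian \<epsilon>) = lyap \<beta> M (meridian \<delta>) \<longleftrightarrow> \<epsilon> = \<delta>"
  using lyap_meridian_strict_mono[OF assms] lyap_meridian_strict_mono[OF assms(2,1)]
  by (cases \<epsilon> \<delta> rule: linorder_cases) auto

text \<open>The meridian is a global cross-section: off the axis the angle grows without bound, and
  the poles lie on the meridian themselves. With strict monotonicity of \<open>lyap\<close>, each
  level set on the surface is a single orbit.\<close>

lemma orbit_meets_meridian:
  assumes p: "p \<in> SigmaM M"
  obtains \<epsilon> where "\<epsilon> \<in> {0..2}" "orbit \<beta> p = orbit \<beta> (meridian \<epsilon>)"
    "lyap \<beta> M p = lyap \<beta> M (meridian \<epsilon>)"
proof -
  obtain x\<^sub>0 y\<^sub>0 z\<^sub>0 where xyz: "p = (x\<^sub>0, y\<^sub>0, z\<^sub>0)" by (cases p)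
  have "\<exists>t. fst (snd (flow \<beta> t p)) = 0 \<and> fst (flow \<beta> t p) \<ge> 0"
  proof (cases "x\<^sub>0 = 0 \<and> y\<^sub>0 = 0")
    case True
    then show ?thesis
      by (intro exI[of _ 0]) (simp add: xyz)
  next
    case False
    note ab = weights(1,2)
    have s_nz: "s \<noteq> 0"
      using s_simps(1) by auto
    define \<rho>\<^sub>0 where "\<rho>\<^sub>0 = sqrt ((x\<^sub>0 / a)\<^sup>2 + (s * y\<^sub>0 / b)\<^sup>2)"
    have pos: "(x\<^sub>0 / a)\<^sup>2 + (s * y\<^sub>0 / b)\<^sup>2 > 0"
      using False ab s_nz by (auto simp: sum_power2_gt_zero_iff)
    then have \<rho>\<^sub>0: "\<rho>\<^sub>0 > 0" "\<rho>\<^sub>0\<^sup>2 = (x\<^sub>0 / a)\<^sup>2 + (s * y\<^sub>0 / b)\<^sup>2"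
      by (simp_all add: \<rho>\<^sub>0_def)
    have "(x\<^sub>0 / a / \<rho>\<^sub>0)\<^sup>2 + (- (s * y\<^sub>0 / b) / \<rho>\<^sub>0)\<^sup>2 = 1"
      unfolding power_divide[of _ \<rho>\<^sub>0] power2_minus add_divide_distrib[symmetric] \<rho>\<^sub>0(2)[symmetric]
      using \<rho>\<^sub>0(1) by simp
    then obtain \<psi>\<^sub>0 where \<psi>\<^sub>0: "0 \<le> \<psi>\<^sub>0" "\<psi>\<^sub>0 < 2 * pi" "x\<^sub>0 / a / \<rho>\<^sub>0 = cos \<psi>\<^sub>0" "- (s * y\<^sub>0 / b) / \<rho>\<^sub>0 = sin \<psi>\<^sub>0"
      by (rule sincos_total_2pi)
    have "x\<^sub>0 = \<rho>\<^sub>0 * a * cos \<psi>\<^sub>0" "y\<^sub>0 = - s * \<rho>\<^sub>0 * b * sin \<psi>\<^sub>0"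
      unfolding \<psi>\<^sub>0(3,4)[symmetric] using ab \<rho>\<^sub>0(1) s_simps(1) by (simp_all flip: mult.assoc)
    from flow_rotation[OF p xyz this \<rho>\<^sub>0(1)]
    obtain \<psi> \<psi>' c where \<psi>: "\<psi> 0 = \<psi>\<^sub>0" "\<And>t. (\<psi> has_real_derivative \<psi>' t) (at t)"
      "c > 0" "\<And>t. c \<le> \<psi>' t"
      "\<And>t. \<exists>r>0. fst (flow \<beta> t p) = r * a * cos (\<psi> t) \<and> fst (snd (flow \<beta> t p)) = - s * r * b * sin (\<psi> t)"
      by metis
    \<comment> \<open>The starting angle lies in [0, 2 pi), hence strictly below this value, at
      which y = 0 and x > 0.\<close>
    obtain t where "\<psi> t = 2 * pi"
      using derivative_ge_reaches[OF \<psi>(2-4), of "2 * pi"] \<psi>(1) \<psi>\<^sub>0(2) by auto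
    then show ?thesis
      using \<psi>(5)[of t] ab by (auto intro!: exI[of _ t])
  qed
  then obtain t x z where t: "flow \<beta> t p = (x, 0, z)" "x \<ge> 0"
    by (metis prod.collapse)
  then obtain \<epsilon> where \<epsilon>: "\<epsilon> \<in> {0..2}" "(x, 0, z) = meridian \<epsilon>"
    using meridian_exhausts flow_in_SigmaM[OF p, of \<beta> t] by metis
  show ?thesis
    using that[OF \<epsilon>(1)] orbit_flow[of \<beta> t p] lyap_flow[of \<beta> M t p] t(1) \<epsilon>(2) by simp
qed

text \<open>After one turn the orbit is back on the meridian with the same \<open>lyap\<close>,
  hence at its starting point. The second part is the mean value theorem: 2 pi equals the period
  times an intermediate angular velocity.\<close>

lemma meridian_periodic:
  assumes \<epsilon>: "0 < \<epsilon>" "\<epsilon> < 2"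
  shows "\<exists>T. periodic_point \<beta> (meridian \<epsilon>) T \<and>
    (\<forall>\<eta>. (\<forall>t. \<bar>snd (snd (flow \<beta> t (meridian \<epsilon>))) - M\<bar> \<le> \<eta>) \<longrightarrow> \<bar>2 * pi - \<omega> * T\<bar> \<le> K * \<eta> * T)"
proof -
  note ab = weights(1,2)
  have s_nz: "s \<noteq> 0"
    using s_simps(1) by auto
  define p where "p = meridian \<epsilon>"
  define x\<^sub>0 where "x\<^sub>0 = \<bar>M\<bar> * sqrt (2 * \<epsilon> * (2 - \<epsilon>))"
  have p: "p \<in> SigmaM M" "p = (x\<^sub>0, 0, M * (1 - \<epsilon>))"
    using meridian_in_SigmaM[of \<epsilon>] \<epsilon> by (auto simp: p_def meridian_def x\<^sub>0_def)
  have x0: "x\<^sub>0 > 0"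
    using \<epsilon> M_nz by (simp add: x\<^sub>0_def)
  have init: "x\<^sub>0 = x\<^sub>0 / a * a * cos 0" "0 = - s * (x\<^sub>0 / a) * b * sin 0" "x\<^sub>0 / a > 0"
    using ab x0 by auto
  from flow_rotation[OF p init]
  obtain \<psi> \<psi>' c where \<psi>: "\<psi> 0 = 0" and \<psi>': "\<And>t. (\<psi> has_real_derivative \<psi>' t) (at t)"
    and c: "c > 0" "\<And>t. c \<le> \<psi>' t"
    and freq: "\<And>\<eta> t. (\<And>t. \<bar>snd (snd (flow \<beta> t p)) - M\<bar> \<le> \<eta>) \<Longrightarrow> \<bar>\<psi>' t - \<omega>\<bar> \<le> K * \<eta>"
    and polar: "\<And>t. \<exists>r>0. fst (flow \<beta> t p) = r * a * cos (\<psi> t) \<and> fst (snd (flow \<beta> t p)) = - s * r * b * sin (\<psi> t)"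
    by metis
  obtain T where T: "T > 0" "\<psi> T = 2 * pi"
    using derivative_ge_reaches[OF \<psi>' c, of "2 * pi"] \<psi> by auto
  have "flow \<beta> T p = p"
  proof -
    obtain x z where xz: "flow \<beta> T p = (x, 0, z)" "x \<ge> 0"
      using polar[of T] T(2) ab by (cases "flow \<beta> T p") auto
    then obtain \<delta> where \<delta>: "\<delta> \<in> {0..2}" "(x, 0, z) = meridian \<delta>"
      using meridian_exhausts flow_in_SigmaM[OF p(1), of \<beta> T] by metis
    have "lyap \<beta> M (meridian \<delta>) = lyap \<beta> M (meridian \<epsilon>)"
      using lyap_flow[of \<beta> M T p, unfolded xz(1) \<delta>(2)] by (simp add: p_def)
    then have "\<delta> = \<epsilon>"
      using lyap_meridian_eq_iff[OF \<delta>(1), of \<epsilon>] \<epsilon> by simp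
    then show ?thesis
      using xz(1) \<delta>(2) by (metis p_def)
  qed
  moreover have "flow \<beta> t p \<noteq> p" if t: "0 < t" "t < T" for t
  proof
    assume "flow \<beta> t p = p"
    then obtain r where r: "r > 0" "r * a * cos (\<psi> t) > 0" "s * r * b * sin (\<psi> t) = 0"
      using polar[of t] p(2) x0 by auto
    have "r * a > 0"
      using r(1) ab by simp
    \<comment> \<open>An earlier return would need an angle strictly between 0 and 2 pi with
      vanishing sine and positive cosine.\<close>
    then have sc: "sin (\<psi> t) = 0" "cos (\<psi> t) > 0"
      using r s_nz ab zero_less_mult_pos[OF r(2)] by simp_all
    have mono: "\<psi> u < \<psi> v" if "u < v" for u v
      by (rule DERIV_pos_imp_increasing[OF that]) (use \<psi>' c in \<open>meson less_le_trans\<close>)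
    have "0 < \<psi> t" "\<psi> t < 2 * pi"
      using mono[OF t(1)] mono[OF t(2)] \<psi> T(2) by auto
    moreover have "\<not> \<psi> t < pi"
      using sin_gt_zero[of "\<psi> t"] sc \<open>0 < \<psi> t\<close> by auto
    moreover have "\<psi> t \<noteq> pi"
      using sc by auto
    ultimately show False
      using sin_lt_zero[of "\<psi> t"] sc by auto
  qed
  moreover have "\<bar>2 * pi - \<omega> * T\<bar> \<le> K * \<eta> * T" if "\<forall>t. \<bar>snd (snd (flow \<beta> t p)) - M\<bar> \<le> \<eta>" for \<eta>
  proof -
    obtain \<xi> where "\<psi> T - \<psi> 0 = (T - 0) * \<psi>' \<xi>"
      using MVT2[OF T(1), of \<psi> \<psi>'] \<psi>' by auto
    then have "2 * pi - \<omega> * T = (\<psi>' \<xi> - \<omega>) * T"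
      using T(2) \<psi> by (simp add: algebra_simps)
    then have "\<bar>2 * pi - \<omega> * T\<bar> = \<bar>\<psi>' \<xi> - \<omega>\<bar> * T"
      using T(1) by (simp add: abs_mult)
    also have "\<dots> \<le> K * \<eta> * T"
      using T(1) freq[of \<eta> \<xi>] that by (intro mult_right_mono) auto
    finally show ?thesis .
  qed
  ultimately show ?thesis
    using T(1) unfolding periodic_point_def p_def by blast
qed

text \<open>The radius of a ball around the pole containing the whole orbit through
  \<open>meridian \<epsilon>\<close>, hence also a bound for |z - M| along it.\<close>

definition \<eta> :: "real \<Rightarrow> real" where
  "\<eta> \<epsilon> = sqrt (2 * lyap \<beta> M (meridian \<epsilon>) / (\<bar>\<beta>\<bar> * (\<bar>\<beta>\<bar> - \<bar>M\<bar>)))"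

lemma eta_tendsto_0: "(\<eta> \<longlongrightarrow> 0) (at_right 0)"
proof -
  have "continuous_on UNIV \<eta>"
    unfolding \<eta>_def using M_less
    by (intro continuous_intros continuous_on_compose2[OF continuous_on_lyap continuous_on_meridian]) auto
  then have "(\<eta> \<longlongrightarrow> \<eta> 0) (at 0)"
    by (simp add: continuous_on_def)
  then show ?thesis
    by (simp add: \<eta>_def filterlim_at_split)
qed

lemma orbit_meridian_dist:
  "\<epsilon> \<in> {0..2} \<Longrightarrow> q \<in> orbit \<beta> (meridian \<epsilon>) \<Longrightarrow> dist q (0, 0, M) \<le> \<eta> \<epsilon>"
  unfolding \<eta>_def by (rule orbit_dist_pole_le[OF meridian_in_SigmaM M_less])

text \<open>The error bound contains the period itself. Once K \<eta> is below \<omega> / 2 it first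
  yields T \<le> 4 pi / \<omega>, and reinserting this gives an error proportional to
  \<eta>.\<close>

lemma period_tendsto:
  assumes "\<And>\<epsilon>. 0 < \<epsilon> \<Longrightarrow> \<epsilon> \<le> 1 \<Longrightarrow> T \<epsilon> > 0"
    and bnd: "\<And>\<epsilon>. 0 < \<epsilon> \<Longrightarrow> \<epsilon> \<le> 1 \<Longrightarrow> \<bar>2 * pi - \<omega> * T \<epsilon>\<bar> \<le> K * \<eta> \<epsilon> * T \<epsilon>"
  shows "(T \<longlongrightarrow> 2 * pi / \<omega>) (at_right 0)"
proof (rule Lim_null[THEN iffD2], rule Lim_null_comparison)
  have "((\<lambda>\<epsilon>. K * \<eta> \<epsilon>) \<longlongrightarrow> K * 0) (at_right 0)"
    by (intro tendsto_intros eta_tendsto_0)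
  then have "\<forall>\<^sub>F \<epsilon> in at_right 0. K * \<eta> \<epsilon> < \<omega> / 2"
    using weights(6) by (intro order_tendstoD(2)[where y="K * 0"]) auto
  moreover have "\<forall>\<^sub>F \<epsilon> :: real in at_right 0. 0 < \<epsilon> \<and> \<epsilon> \<le> 1"
    by (auto intro!: eventually_at_rightI[of 0 1])
  ultimately show "\<forall>\<^sub>F \<epsilon> in at_right 0. norm (T \<epsilon> - 2 * pi / \<omega>) \<le> 4 * pi / \<omega>\<^sup>2 * (K * \<eta> \<epsilon>)"
  proof eventually_elim
    case (elim \<epsilon>)
    define k where "k = K * \<eta> \<epsilon>"
    have T: "T \<epsilon> > 0" "\<bar>2 * pi - \<omega> * T \<epsilon>\<bar> \<le> k * T \<epsilon>"
      using elim assms by (auto simp: k_def)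
    have "0 \<le> k * T \<epsilon>"
      using T(2) by linarith
    then have k: "k \<ge> 0"
      using T(1) by (simp add: zero_le_mult_iff)
    have "k * T \<epsilon> \<le> \<omega> / 2 * T \<epsilon>"
      using elim T(1) by (intro mult_right_mono) (auto simp: k_def)
    then have T_le: "T \<epsilon> \<le> 4 * pi / \<omega>"
      using T(2) weights(6) by (simp add: field_simps)
    have "\<omega> * (T \<epsilon> - 2 * pi / \<omega>) = - (2 * pi - \<omega> * T \<epsilon>)"
      using weights(6) by (simp add: field_simps)
    then have "\<omega> * \<bar>T \<epsilon> - 2 * pi / \<omega>\<bar> = \<bar>2 * pi - \<omega> * T \<epsilon>\<bar>"
      using weights(6) by (metis abs_minus_cancel abs_mult abs_of_pos)
    also have "\<dots> \<le> k * (4 * pi / \<omega>)"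
      using T(2) mult_left_mono[OF T_le k] by linarith
    finally show ?case
      using weights(6) by (simp add: field_simps power2_eq_square k_def)
  qed
  have "((\<lambda>\<epsilon>. 4 * pi / \<omega>\<^sup>2 * (K * \<eta> \<epsilon>)) \<longlongrightarrow> 4 * pi / \<omega>\<^sup>2 * (K * 0)) (at_right 0)"
    by (intro tendsto_intros eta_tendsto_0)
  then show "((\<lambda>\<epsilon>. 4 * pi / \<omega>\<^sup>2 * (K * \<eta> \<epsilon>)) \<longlongrightarrow> 0) (at_right 0)"
    by simp
qed

lemma lyap_orbit: "q \<in> orbit \<beta> p \<Longrightarrow> lyap \<beta> M q = lyap \<beta> M p"
  by (auto simp: orbit_def)

lemma orbit_subset_SigmaM: "p \<in> SigmaM M \<Longrightarrow> orbit \<beta> p \<subseteq> SigmaM M"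
  by (auto simp: orbit_def intro: flow_in_SigmaM)

text \<open>The right-hand side is the part of the surface where \<open>lyap\<close> is below its
  value on the removed orbit. It is connected since all its orbits hang on one arc of the meridian;
  the component cannot be larger, as \<open>lyap\<close> would have to pass through the removed
  value.\<close>

lemma component_inside_orbit:
  assumes e: "0 < e" "e \<le> 2"
  shows "connected_component_set (SigmaM M - orbit \<beta> (meridian e)) (0, 0, M) =
    insert (0, 0, M) (\<Union>\<epsilon>\<in>{0<..<e}. orbit \<beta> (meridian \<epsilon>))" (is "?C = ?U")
proof
  have lt: "lyap \<beta> M (meridian \<epsilon>) < lyap \<beta> M (meridian e)" if "0 \<le> \<epsilon>" "\<epsilon> < e" for \<epsilon>
    using that e by (intro lyap_meridian_strict_mono) auto
  have orbit_0: "orbit \<beta> (0, 0, M) = {(0, 0, M)}"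
    by (auto simp: orbit_def)
  have U: "?U = (\<Union>\<epsilon>\<in>{0..<e}. orbit \<beta> (meridian \<epsilon>))"
  proof -
    have "{0..<e} = insert 0 {0<..<e}"
      using e by auto
    then show ?thesis
      by (simp add: orbit_0)
  qed
  show "?U \<subseteq> ?C"
  proof (rule connected_component_maximal)
    have "meridian ` {0..<e} \<subseteq> (\<Union>\<epsilon>\<in>{0..<e}. orbit \<beta> (meridian \<epsilon>))"
      by (rule image_subsetI) (rule UN_I, assumption, rule orbit_self)
    then have "?U = meridian ` {0..<e} \<union> (\<Union>\<epsilon>\<in>{0..<e}. orbit \<beta> (meridian \<epsilon>))"
      unfolding U by (simp only: Un_absorb1)
    also have "connected \<dots>"
    proof -
      \<comment> \<open>Each orbit is joined to the arc beforehand, so that all members of the union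
        share the pole.\<close>
      have "connected (\<Union>(insert (meridian ` {0..<e}) ((\<lambda>\<epsilon>. meridian ` {0..<e} \<union> orbit \<beta> (meridian \<epsilon>)) ` {0..<e})))"
      proof (rule connected_Union)
        have arc: "connected (meridian ` {0..<e})"
          by (intro connected_continuous_image continuous_on_meridian) auto
        then show "connected S" if "S \<in> insert (meridian ` {0..<e})
            ((\<lambda>\<epsilon>. meridian ` {0..<e} \<union> orbit \<beta> (meridian \<epsilon>)) ` {0..<e})" for S
          using that by (auto intro!: connected_Un connected_orbit intro: orbit_self)
        have "meridian 0 \<in> meridian ` {0..<e}"
          by (rule imageI) (use e in simp)
        then show "\<Inter>(insert (meridian ` {0..<e})
            ((\<lambda>\<epsilon>. meridian ` {0..<e} \<union> orbit \<beta> (meridian \<epsilon>)) ` {0..<e})) \<noteq> {}"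
          by blast
      qed
      then show ?thesis
        by (rule back_subst[of connected]) auto
    qed
    finally show "connected ?U" .
    show "?U \<subseteq> SigmaM M - orbit \<beta> (meridian e)"
      unfolding U
    proof
      fix q assume "q \<in> (\<Union>\<epsilon>\<in>{0..<e}. orbit \<beta> (meridian \<epsilon>))"
      then obtain \<epsilon> where \<epsilon>: "0 \<le> \<epsilon>" "\<epsilon> < e" "q \<in> orbit \<beta> (meridian \<epsilon>)"
        by auto
      then have "q \<in> SigmaM M"
        using orbit_subset_SigmaM[OF meridian_in_SigmaM, of \<epsilon>] e by auto
      moreover have "lyap \<beta> M q < lyap \<beta> M (meridian e)"
        using lt[OF \<epsilon>(1,2)] lyap_orbit[OF \<epsilon>(3)] by simp
      ultimately show "q \<in> SigmaM M - orbit \<beta> (meridian e)"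
        using lyap_orbit[of q "meridian e"] by auto
    qed
  qed simp
  show "?C \<subseteq> ?U"
  proof
    fix q assume q: "q \<in> ?C"
    have C: "?C \<subseteq> SigmaM M - orbit \<beta> (meridian e)"
      by (rule connected_component_subset)
    \<comment> \<open>A point of the surface at the critical level lies on the removed orbit,
      because that level is a single orbit.\<close>
    have neq: "lyap \<beta> M r \<noteq> lyap \<beta> M (meridian e)" if r: "r \<in> ?C" for r
    proof
      assume eq: "lyap \<beta> M r = lyap \<beta> M (meridian e)"
      obtain \<epsilon> where "\<epsilon> \<in> {0..2}" "orbit \<beta> r = orbit \<beta> (meridian \<epsilon>)"
        "lyap \<beta> M r = lyap \<beta> M (meridian \<epsilon>)"
        using orbit_meets_meridian[of r] r C by blast
      then have "orbit \<beta> r = orbit \<beta> (meridian e)"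
        using eq lyap_meridian_eq_iff[of \<epsilon> e] e by simp
      then show False
        using orbit_self[of r \<beta>] r C by blast
    qed
    have m: "(0, 0, M) \<in> ?C"
      using q connected_component_in connected_component_refl unfolding mem_Collect_eq by metis
    have "connected (lyap \<beta> M ` ?C)"
      by (intro connected_continuous_image continuous_on_lyap connected_connected_component)
    then have "lyap \<beta> M (meridian e) \<in> lyap \<beta> M ` ?C"
      if "lyap \<beta> M (meridian e) \<le> lyap \<beta> M q"
      by (rule connectedD_interval[OF _ imageI[OF m] imageI[OF q]]) (use that lt[of 0] e in auto)
    then have "lyap \<beta> M q < lyap \<beta> M (meridian e)"
      using neq by (metis imageE not_le)
    moreover obtain \<epsilon> where \<epsilon>: "\<epsilon> \<in> {0..2}" "orbit \<beta> q = orbit \<beta> (meridian \<epsilon>)"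
      "lyap \<beta> M q = lyap \<beta> M (meridian \<epsilon>)"
      using orbit_meets_meridian[of q] q C by blast
    ultimately have "\<epsilon> < e"
      using lyap_meridian_strict_mono[of e \<epsilon>] e by (cases \<epsilon> e rule: linorder_cases) auto
    then show "q \<in> ?U"
      unfolding U using \<epsilon> orbit_self[of q \<beta>] by auto
  qed
qed

end

theorem theorem7p2:
  fixes \<beta> M :: real
  assumes "\<beta> \<noteq> 0" and "M \<noteq> 0"
  shows "has_charpoly2 (tangent_space (SigmaM M) (0, 0, M)) (linearization \<beta> (0, 0, M))
            [:\<beta>^2 - M^2, 0, 1:] \<and>
       (\<bar>\<beta>\<bar> < \<bar>M\<bar> \<longrightarrow> \<not> lyapunov_stable_on \<beta> (SigmaM M) (0, 0, M)) \<and>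
       (\<bar>\<beta>\<bar> > \<bar>M\<bar> \<longrightarrow> lyapunov_stable_on \<beta> (SigmaM M) (0, 0, M)) \<and>
       (\<bar>\<beta>\<bar> > \<bar>M\<bar> \<longrightarrow>
       (\<exists>e0 > 0. \<exists>(p :: real \<Rightarrow> real \<times> real \<times> real) (T :: real \<Rightarrow> real).
         (\<forall>ep. 0 < ep \<and> ep \<le> e0 \<longrightarrow> p ep \<in> SigmaM M \<and> periodic_point \<beta> (p ep) (T ep)) \<and>
         (\<forall>eta>0. \<exists>dl>0. \<forall>ep. 0 < ep \<and> ep \<le> e0 \<and> ep < dl \<longrightarrow> orbit \<beta> (p ep) \<subseteq> ball (0, 0, M) eta) \<and>
         (T \<longlongrightarrow> 2 * pi / sqrt (\<beta>^2 - M^2)) (at_right 0) \<and>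
         connected_component_set (SigmaM M - orbit \<beta> (p e0)) (0, 0, M) =
           insert (0, 0, M) (\<Union>ep\<in>{0<..<e0}. orbit \<beta> (p ep))))"
proof (intro conjI impI)
  show "has_charpoly2 (tangent_space (SigmaM M) (0, 0, M)) (linearization \<beta> (0, 0, M))
      [:\<beta>^2 - M^2, 0, 1:]"
    unfolding tangent_space_pole[OF assms(2)] linearization_pole[abs_def]
    by (rule charpoly_pole_matrix)
next
  assume "\<bar>\<beta>\<bar> < \<bar>M\<bar>"
  then show "\<not> lyapunov_stable_on \<beta> (SigmaM M) (0, 0, M)"
    by (rule not_lyapunov_stable_pole)
next
  assume "\<bar>M\<bar> < \<bar>\<beta>\<bar>"
  then show "lyapunov_stable_on \<beta> (SigmaM M) (0, 0, M)"
    by (rule lyapunov_stable_pole)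
next
  assume "\<bar>M\<bar> < \<bar>\<beta>\<bar>"
  then interpret elliptic_pole \<beta> M
    using assms(2) by unfold_locales
  have z: "\<bar>snd (snd (flow \<beta> t (meridian \<epsilon>))) - M\<bar> \<le> \<eta> \<epsilon>" if "0 < \<epsilon>" "\<epsilon> \<le> 1" for t \<epsilon>
  proof -
    obtain x y z where xyz: "flow \<beta> t (meridian \<epsilon>) = (x, y, z)" by (cases "flow \<beta> t (meridian \<epsilon>)")
    have "dist (x, y, z) (0, 0, M) \<le> \<eta> \<epsilon>"
      using orbit_meridian_dist[of \<epsilon> "flow \<beta> t (meridian \<epsilon>)"] that by (simp add: orbit_def xyz[symmetric])
    then show ?thesis
      using abs_le_norm_triple(3)[where x=x and y=y and z="z - M"] by (simp add: xyz dist_norm)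
  qed
  have "\<exists>T. periodic_point \<beta> (meridian \<epsilon>) T \<and> \<bar>2 * pi - \<omega> * T\<bar> \<le> K * \<eta> \<epsilon> * T"
    if "0 < \<epsilon>" "\<epsilon> \<le> 1" for \<epsilon>
    using meridian_periodic[of \<epsilon>] z[OF that] that by fastforce
  then obtain T where T: "\<And>\<epsilon>. 0 < \<epsilon> \<Longrightarrow> \<epsilon> \<le> 1 \<Longrightarrow>
      periodic_point \<beta> (meridian \<epsilon>) (T \<epsilon>) \<and> \<bar>2 * pi - \<omega> * T \<epsilon>\<bar> \<le> K * \<eta> \<epsilon> * T \<epsilon>"
    by metis
  have "\<exists>dl>0. \<forall>ep. 0 < ep \<and> ep \<le> 1 \<and> ep < dl \<longrightarrow> orbit \<beta> (meridian ep) \<subseteq> ball (0, 0, M) r"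
    if "r > 0" for r
  proof -
    have "\<forall>\<^sub>F \<epsilon> in at_right 0. \<eta> \<epsilon> < r"
      using order_tendstoD(2)[OF eta_tendsto_0 that] .
    then obtain d where d: "d > 0" "\<And>\<epsilon>. 0 < \<epsilon> \<Longrightarrow> \<epsilon> < d \<Longrightarrow> \<eta> \<epsilon> < r"
      unfolding eventually_at_right_field by auto
    have "orbit \<beta> (meridian ep) \<subseteq> ball (0, 0, M) r" if "0 < ep" "ep \<le> 1" "ep < d" for ep
    proof
      fix q assume "q \<in> orbit \<beta> (meridian ep)"
      then have "dist q (0, 0, M) \<le> \<eta> ep"
        using orbit_meridian_dist that by simp
      then show "q \<in> ball (0, 0, M) r"
        using d(2)[of ep] that by (simp add: dist_commute)
    qed
    then show ?thesis
      using d(1) by blast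
  qed
  moreover have "(T \<longlongrightarrow> 2 * pi / sqrt (\<beta>\<^sup>2 - M\<^sup>2)) (at_right 0)"
    unfolding \<omega>_def[symmetric] by (rule period_tendsto) (use T in \<open>auto simp: periodic_point_def\<close>)
  moreover have "meridian ep \<in> SigmaM M \<and> periodic_point \<beta> (meridian ep) (T ep)" if "0 < ep" "ep \<le> 1" for ep
    using meridian_in_SigmaM T that by simp
  ultimately show "\<exists>e0 > 0. \<exists>(p :: real \<Rightarrow> real \<times> real \<times> real) (T :: real \<Rightarrow> real).
      (\<forall>ep. 0 < ep \<and> ep \<le> e0 \<longrightarrow> p ep \<in> SigmaM M \<and> periodic_point \<beta> (p ep) (T ep)) \<and>
      (\<forall>eta>0. \<exists>dl>0. \<forall>ep. 0 < ep \<and> ep \<le> e0 \<and> ep < dl \<longrightarrow> orbit \<beta> (p ep) \<subseteq> ball (0, 0, M) eta) \<and>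
      (T \<longlongrightarrow> 2 * pi / sqrt (\<beta>^2 - M^2)) (at_right 0) \<and>
      connected_component_set (SigmaM M - orbit \<beta> (p e0)) (0, 0, M) =
        insert (0, 0, M) (\<Union>ep\<in>{0<..<e0}. orbit \<beta> (p ep))"
    \<comment> \<open>The value 1 is a convenient choice of \<open>e0\<close> below 2, where the
      meridian reaches the antipodal equilibrium and periodicity ends.\<close>
    using component_inside_orbit[of 1]
    by (intro exI[of _ "1 :: real"] exI[of _ meridian] exI[of _ T] conjI) auto
qed

end
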